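(* Let $F,G\in\mathbb{C}^{M\times N}$ be constant matrices such that the matrix pencil $sF-G$ is singular, and consider the system $$F\,Y'(t)=G\,Y(t)$$ with known initial condition $Y(t_0)\in\mathbb{C}^{N}$. Let $P,Q$ be nonsingular matrices bringing the pencil to its Kronecker canonical form, $PFQ=F_K$, $PGQ=G_K$, and let $Q_p$ and $J_p$ be the corresponding matrices described in the context. Then the system with the given initial condition has a unique solution if and only if there are no column minimal indices, i.e. $$\dim\mathcal{N}_r(sF-G)=0,$$ and $$Y(t_0)\in\operatorname{colspan} Q_p .$$ The unique solution is then given by the formula $$Y(t)=Q_p\,e^{J_p(t-t_0)}\,Z_p(t_0),$$ where $Z_p(t_0)$ is the unique solution of the algebraic system $Y(t_0)=Q_pZ_p(t_0)$. In any other case the system $F\,Y'(t)=G\,Y(t)$ has infinitely many solutions.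
   Context: Solutions are differentiable functions $Y:\mathbb{R}\to\mathbb{C}^N$. The pencil $sF-G$, with $F,G\in\mathbb{C}^{M\times N}$, is called regular if $M=N$ and $\det(sF-G)$ is not identically zero as a polynomial in $s$; otherwise it is called singular. $\mathcal{N}_r(sF-G)$ and $\mathcal{N}_l(sF-G)$ denote the right and left null spaces of $sF-G$ as vector spaces over the field of rational functions $\mathbb{C}(s)$, of dimensions $d$ and $t$ respectively. The column minimal indices $\epsilon_1=\dots=\epsilon_g=0<\epsilon_{g+1}\le\dots\le\epsilon_d$ are the degrees of the vectors of a minimal polynomial basis of $\mathcal{N}_r(sF-G)$, and the row minimal indices $\zeta_1=\dots=\zeta_h=0<\zeta_{h+1}\le\dots\le\zeta_t$ are those of $\mathcal{N}_l(sF-G)$. Kronecker canonical form: there exist nonsingular $P\in\mathbb{C}^{M\times M}$, $Q\in\mathbb{C}^{N\times N}$ such that $PFQ=F_K$, $PGQ=G_K$, where $sF_K-G_K$ is the block diagonal pencil $$sF_K-G_K=(sI_p-J_p)\oplus(sH_q-I_q)\oplus(sF_\epsilon-G_\epsilon)\oplus(sF_\zeta-G_\zeta)\oplus 0_{h,g}.$$ Here: - $J_p=J_{p_1}(a_1)\oplus\dots\oplus J_{p_\nu}(a_\nu)$, with $J_{p_j}(a_j)$ the $p_j\times p_j$ upper Jordan block with eigenvalue $a_j$, corresponding to the finite elementary divisors $(s-a_j)^{p_j}$, $\sum_j p_j=p$. - $H_q=H_{q_1}\oplus\dots\oplus H_{q_\sigma}$, with $H_{q_j}$ the $q_j\times q_j$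 nilpotent upper Jordan block, corresponding to the infinite elementary divisors of degrees $q_j$, $\sum_j q_j=q$. - $F_\epsilon$ and $G_\epsilon$ are block diagonal with blocks $[\,I_{\epsilon_i}\ \ 0_{\epsilon_i,1}]$ and $[\,0_{\epsilon_i,1}\ \ I_{\epsilon_i}]$ respectively, $i=g+1,\dots,d$. - $F_\zeta$ and $G_\zeta$ are block diagonal with blocks $\begin{bmatrix} I_{\zeta_j} \\ 0_{1,\zeta_j} \end{bmatrix}$ and $\begin{bmatrix} 0_{1,\zeta_j} \\ I_{\zeta_j} \end{bmatrix}$ respectively, $j=h+1,\dots,t$. - $0_{h,g}$ is the $h\times g$ zero matrix. Any of these blocks may be absent. Partition the columns of $Q$ conformably with the column blocks of $F_K$: $Q=[\,Q_p\ Q_q\ Q_\epsilon\ Q_\zeta\ Q_g\,]$; thus $Q_p\in\mathbb{C}^{N\times p}$ consists of the first $p$ columns of $Q$, and $\operatorname{colspan}Q_p$ is its column space.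
   Formalization: The last sentence is proved except when dim N_r = 0 and p = 0 (J_p absent); there the system has only the zero solution, so it fails for nonzero Y(t_0), e.g. F=(1,0)^T, G=(0,1)^T, Y(t_0)=1. *)

theory Defs
  imports
    Complex_Main
    "HOL-Computational_Algebra.Fraction_Field"
    "HOL-Computational_Algebra.Normalized_Fraction"
    "Jordan_Normal_Form.Matrix_Kernel"
    "Jordan_Normal_Form.Jordan_Normal_Form"
begin

definition pencil :: "complex mat \<Rightarrow> complex mat \<Rightarrow> complex poly mat" where
  "pencil F G = [:0, 1:] \<cdot>\<^sub>m map_mat (\<lambda>c. [:c:]) F - map_mat (\<lambda>c. [:c:]) G"

definition regular_pencil :: "complex mat \<Rightarrow> complex mat \<Rightarrow> bool" where
  "regular_pencil F G \<longleftrightarrow> dim_row F = dim_col F \<and> det (pencil F G) \<noteq> 0"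

abbreviation singular_pencil :: "complex mat \<Rightarrow> complex mat \<Rightarrow> bool" where
  "singular_pencil F G \<equiv> \<not> regular_pencil F G"

text \<open>The pencil over the field \<open>\<complex>(s)\<close>, represented as the fraction field of \<open>\<complex>[s]\<close>; the
  dimension of its right null space over that field is the number of column minimal indices.\<close>

definition rat_pencil :: "complex mat \<Rightarrow> complex mat \<Rightarrow> complex poly fract mat" where
  "rat_pencil F G = map_mat to_fract (pencil F G)"

definition dim_right_null :: "complex mat \<Rightarrow> complex mat \<Rightarrow> nat" where
  "dim_right_null F G = kernel_dim (rat_pencil F G)"

text \<open>\<open>[I 0]\<close> and \<open>[0 I]\<close>, of size \<open>e \<times> (e + 1)\<close>. The blocks for the row minimal indices are the
  transposes of these.\<close>

definition left_id_block :: "nat \<Rightarrow> complex mat" where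
  "left_id_block e = mat e (e + 1) (\<lambda>(i, j). if j = i then 1 else 0)"

definition right_id_block :: "nat \<Rightarrow> complex mat" where
  "right_id_block e = mat e (e + 1) (\<lambda>(i, j). if j = Suc i then 1 else 0)"

text \<open>Data of a Kronecker canonical form: \<open>jbs\<close> lists the pairs \<open>(p\<^sub>j, a\<^sub>j)\<close> of the finite elementary
  divisors, \<open>qs\<close> the degrees of the infinite ones, \<open>es\<close> and \<open>zs\<close> the nonzero column and row minimal
  indices; \<open>g\<close> and \<open>h\<close> count the zero column and row minimal indices. All lists may be empty.\<close>

definition kronecker_data ::
  "(nat \<times> complex) list \<Rightarrow> nat list \<Rightarrow> nat list \<Rightarrow> nat list \<Rightarrow> bool" where
  "kronecker_data jbs qs es zs \<longleftrightarrow>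
     (\<forall>(n, a) \<in> set jbs. n > 0) \<and> (\<forall>n \<in> set qs. n > 0) \<and>
     (\<forall>n \<in> set es. n > 0) \<and> sorted es \<and> (\<forall>n \<in> set zs. n > 0) \<and> sorted zs"

text \<open>\<open>diag_block_mat\<close> also accepts rectangular and empty blocks.\<close>

definition kronecker_F ::
  "(nat \<times> complex) list \<Rightarrow> nat list \<Rightarrow> nat list \<Rightarrow> nat list \<Rightarrow> nat \<Rightarrow> nat \<Rightarrow> complex mat" where
  "kronecker_F jbs qs es zs h g = diag_block_mat
     [1\<^sub>m (sum_list (map fst jbs)),
      jordan_matrix (map (\<lambda>n. (n, 0)) qs),
      diag_block_mat (map left_id_block es),
      diag_block_mat (map (\<lambda>n. transpose_mat (left_id_block n)) zs),
      0\<^sub>m h g]"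

definition kronecker_G ::
  "(nat \<times> complex) list \<Rightarrow> nat list \<Rightarrow> nat list \<Rightarrow> nat list \<Rightarrow> nat \<Rightarrow> nat \<Rightarrow> complex mat" where
  "kronecker_G jbs qs es zs h g = diag_block_mat
     [jordan_matrix jbs,
      1\<^sub>m (sum_list qs),
      diag_block_mat (map right_id_block es),
      diag_block_mat (map (\<lambda>n. transpose_mat (right_id_block n)) zs),
      0\<^sub>m h g]"

definition first_cols :: "nat \<Rightarrow> complex mat \<Rightarrow> complex mat" where
  "first_cols k A = mat (dim_row A) k (\<lambda>(i, j). A $$ (i, j))"

definition colspan :: "complex mat \<Rightarrow> complex vec set" where
  "colspan A = vec_space.col_space (dim_row A) A"

text \<open>The exponential series \<open>\<Sum>k. A\<^sup>k / k!\<close>, summed entry by entry; \<open>A\<close> is a square matrix.\<close>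

definition mat_exp :: "complex mat \<Rightarrow> complex mat" where
  "mat_exp A = mat (dim_row A) (dim_row A) (\<lambda>(i, j). \<Sum>k. (A ^\<^sub>m k) $$ (i, j) / fact k)"

text \<open>Vectors of this library carry their dimension as a value, and there is no topology on them;
  derivatives are therefore taken componentwise.\<close>

definition has_vec_deriv :: "nat \<Rightarrow> (real \<Rightarrow> complex vec) \<Rightarrow> complex vec \<Rightarrow> real \<Rightarrow> bool" where
  "has_vec_deriv n Y D t \<longleftrightarrow> D \<in> carrier_vec n \<and>
     (\<forall>i<n. ((\<lambda>s. Y s $ i) has_vector_derivative D $ i) (at t))"

definition is_solution :: "complex mat \<Rightarrow> complex mat \<Rightarrow> (real \<Rightarrow> complex vec) \<Rightarrow> bool" where
  "is_solution F G Y \<longleftrightarrow> (\<forall>t. Y t \<in> carrier_vec (dim_col F)) \<and>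
     (\<forall>t. \<exists>D. has_vec_deriv (dim_col F) Y D t \<and> F *\<^sub>v D = G *\<^sub>v Y t)"

end

theory Submission
  imports Defs "HOL-Computational_Algebra.Polynomial_Factorial"
begin

text \<open>Strict equivalence turns the system into independent systems for the blocks of the Kronecker form.
  The blocks of the infinite elementary divisors and of the row minimal indices admit only the zero
  solution, and \<open>Z' = J\<^sub>p Z\<close> is solved by the exponential. A rational null vector of the pencil, with
  denominators cleared, is a polynomial \<open>v(s)\<close>, and \<open>v(d/dt) \<phi>\<close> is a solution for every smooth scalar
  \<open>\<phi>\<close>; so a nontrivial right null space destroys uniqueness for every initial value. Conversely, a
  column minimal index \<open>e\<close> yields the null vector \<open>(1, s, \<dots>, s\<^sup>e)\<close>. Only this last implication uses
  the shape of the column blocks.\<close>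

section \<open>Componentwise derivatives and solutions\<close>

text \<open>The null space lives over C(s), the solutions are functions of a real variable;
  \<open>has_poly_null\<close> mediates between the two. Only whether the null space is trivial
  matters, so no dimension is ever computed, and the final case distinction is on the existence of a
  polynomial null vector, not on \<open>es\<close> and \<open>g\<close>. If there is one,
  nonuniqueness is shown for F and G themselves; if there is none, the column blocks are absent and
  an ordinary differential equation remains beside blocks that force zero. Solutions are merely
  differentiable, so a nilpotent block cannot be eliminated by differentiating its equation
  repeatedly. Its components are shown to vanish from the last one upwards instead, each being the
  derivative of a function already known to be zero. Absent blocks are matrices without columns or
  rows, so the block lemmas have to cover these too. The entries of exp(zA) are handled as power
  series in a complex variable z and only then restricted to real times.\<close>

lemma has_vec_derivI:
  assumes "D \<in> carrier_vec n"
    and "\<And>i. i < n \<Longrightarrow> ((\<lambda>s. Y s $ i) has_vector_derivative D $ i) (at t)"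
  shows "has_vec_deriv n Y D t"
  using assms by (auto simp: has_vec_deriv_def)

lemma has_vec_derivD:
  assumes "has_vec_deriv n Y D t"
  shows "D \<in> carrier_vec n"
    and "i < n \<Longrightarrow> ((\<lambda>s. Y s $ i) has_vector_derivative D $ i) (at t)"
  using assms by (auto simp: has_vec_deriv_def)

lemma index_mult_mat_vec_sum:
  assumes "A \<in> carrier_mat m n" "v \<in> carrier_vec n" "i < m"
  shows "(A *\<^sub>v v) $ i = (\<Sum>j<n. A $$ (i, j) * v $ j)"
  using assms by (auto simp: scalar_prod_def atLeast0LessThan intro!: sum.cong)

lemma mult_mat_vec_zero:
  "A \<in> carrier_mat m n \<Longrightarrow> A *\<^sub>v 0\<^sub>v n = (0\<^sub>v m :: 'a :: comm_ring_1 vec)"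
  by (rule eq_vecI) (auto simp: scalar_prod_def)

lemma append_zero_vec: "0\<^sub>v n @\<^sub>v 0\<^sub>v m = 0\<^sub>v (n + m)"
  by (rule eq_vecI) auto

lemma smult_zero_vec_ring: "c \<cdot>\<^sub>v 0\<^sub>v n = (0\<^sub>v n :: 'a :: comm_ring_1 vec)"
  by (rule eq_vecI) auto

lemma has_vector_derivative_cmult:
  fixes f :: "real \<Rightarrow> complex"
  assumes "(f has_vector_derivative d) (at t)"
  shows "((\<lambda>s. c * f s) has_vector_derivative c * d) (at t)"
  using has_vector_derivative_mult[OF has_vector_derivative_const assms, of c] by simp

lemma has_vec_deriv_mult_mat:
  assumes A: "A \<in> carrier_mat m n" and Y: "\<And>s. Y s \<in> carrier_vec n"
    and d: "has_vec_deriv n Y D t"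
  shows "has_vec_deriv m (\<lambda>s. A *\<^sub>v Y s) (A *\<^sub>v D) t"
proof (rule has_vec_derivI)
  note D = has_vec_derivD[OF d]
  show "A *\<^sub>v D \<in> carrier_vec m" using A D(1) by simp
  fix i assume i: "i < m"
  have "((\<lambda>s. \<Sum>j<n. A $$ (i, j) * Y s $ j) has_vector_derivative (\<Sum>j<n. A $$ (i, j) * D $ j)) (at t)"
    by (intro has_vector_derivative_sum has_vector_derivative_cmult D(2)) auto
  then show "((\<lambda>s. (A *\<^sub>v Y s) $ i) has_vector_derivative (A *\<^sub>v D) $ i) (at t)"
    by (simp only: index_mult_mat_vec_sum[OF A Y i] index_mult_mat_vec_sum[OF A D(1) i])
qed

lemma has_vec_deriv_append:
  assumes Y: "\<And>s. Y s \<in> carrier_vec n" and Z: "\<And>s. Z s \<in> carrier_vec m"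
    and d: "has_vec_deriv n Y D t" and e: "has_vec_deriv m Z E t"
  shows "has_vec_deriv (n + m) (\<lambda>s. Y s @\<^sub>v Z s) (D @\<^sub>v E) t"
proof (rule has_vec_derivI)
  note D = has_vec_derivD[OF d] and E = has_vec_derivD[OF e]
  have [simp]: "dim_vec (Y s) = n" "dim_vec (Z s) = m" "dim_vec D = n" "dim_vec E = m" for s
    using Y[of s] Z[of s] D(1) E(1) by auto
  show "D @\<^sub>v E \<in> carrier_vec (n + m)" using D(1) E(1) by auto
  fix i assume i: "i < n + m"
  then show "((\<lambda>s. (Y s @\<^sub>v Z s) $ i) has_vector_derivative (D @\<^sub>v E) $ i) (at t)"
    using D(2)[of i] E(2)[of "i - n"] by (cases "i < n") auto
qed

lemma has_vec_deriv_split: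
  assumes Y: "\<And>s. Y s \<in> carrier_vec (n + m)" and d: "has_vec_deriv (n + m) Y D t"
  shows "has_vec_deriv n (\<lambda>s. vec_first (Y s) n) (vec_first D n) t"
    and "has_vec_deriv m (\<lambda>s. vec_last (Y s) m) (vec_last D m) t"
proof -
  note D = has_vec_derivD[OF d]
  have [simp]: "dim_vec (Y s) = n + m" "dim_vec D = n + m" for s
    using Y[of s] D(1) by auto
  show "has_vec_deriv n (\<lambda>s. vec_first (Y s) n) (vec_first D n) t"
    by (rule has_vec_derivI) (auto simp: vec_first_def intro!: D(2))
  show "has_vec_deriv m (\<lambda>s. vec_last (Y s) m) (vec_last D m) t"
    by (rule has_vec_derivI) (auto simp: vec_last_def intro!: D(2))
qed

lemma is_solution_carrier:
  assumes "is_solution A B Y" "A \<in> carrier_mat m n"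
  shows "Y t \<in> carrier_vec n"
  using assms by (auto simp: is_solution_def)

lemma is_solutionE:
  assumes "is_solution A B Y" "A \<in> carrier_mat m n"
  obtains D where "has_vec_deriv n Y D t" "A *\<^sub>v D = B *\<^sub>v Y t"
  using assms by (auto simp: is_solution_def)

lemma is_solutionI:
  assumes "A \<in> carrier_mat m n" "\<And>t. Y t \<in> carrier_vec n"
    and "\<And>t. has_vec_deriv n Y (D t) t" "\<And>t. A *\<^sub>v D t = B *\<^sub>v Y t"
  shows "is_solution A B Y"
  using assms unfolding is_solution_def by (metis carrier_matD(2))

text \<open>Serves two purposes: with c = 1 it perturbs a solution by one that vanishes at the
  initial time, and with Z = Y it produces a whole line of solutions.\<close>

lemma is_solution_add_smult:
  assumes A: "A \<in> carrier_mat m n" and B: "B \<in> carrier_mat m n"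
    and Y: "is_solution A B Y" and Z: "is_solution A B Z"
  shows "is_solution A B (\<lambda>t. Y t + c \<cdot>\<^sub>v Z t)"
proof -
  note Yc = is_solution_carrier[OF Y A] and Zc = is_solution_carrier[OF Z A]
  have "\<exists>D. has_vec_deriv n (\<lambda>t. Y t + c \<cdot>\<^sub>v Z t) D t \<and> A *\<^sub>v D = B *\<^sub>v (Y t + c \<cdot>\<^sub>v Z t)" for t
  proof -
    obtain D where D: "has_vec_deriv n Y D t" "A *\<^sub>v D = B *\<^sub>v Y t" by (rule is_solutionE[OF Y A])
    obtain E where E: "has_vec_deriv n Z E t" "A *\<^sub>v E = B *\<^sub>v Z t" by (rule is_solutionE[OF Z A])
    note Dc = has_vec_derivD[OF D(1)] and Ec = has_vec_derivD[OF E(1)]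
    have [simp]: "dim_vec (Y s) = n" "dim_vec (Z s) = n" "dim_vec D = n" "dim_vec E = n" for s
      using Yc[of s] Zc[of s] Dc(1) Ec(1) by auto
    have "has_vec_deriv n (\<lambda>t. Y t + c \<cdot>\<^sub>v Z t) (D + c \<cdot>\<^sub>v E) t"
      by (rule has_vec_derivI)
        (use Dc Ec in \<open>auto intro!: has_vector_derivative_add has_vector_derivative_cmult\<close>)
    moreover have "A *\<^sub>v (D + c \<cdot>\<^sub>v E) = B *\<^sub>v (Y t + c \<cdot>\<^sub>v Z t)"
      using D(2) E(2) Dc(1) Ec(1) Yc[of t] Zc[of t] A B
      by (simp add: mult_add_distrib_mat_vec[OF A] mult_add_distrib_mat_vec[OF B] mult_mat_vec[OF A] mult_mat_vec[OF B])
    ultimately show ?thesis by blast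
  qed
  then show ?thesis using A Yc Zc by (auto simp: is_solution_def)
qed

text \<open>The unknown becomes R Y, and Q R = 1 makes the factor Q undo R. Used with P, Q, Q^-1 it
  leads to the Kronecker form; used with P^-1, Q^-1, Q it leads back.\<close>

lemma is_solution_transform:
  assumes F: "F \<in> carrier_mat m n" and G: "G \<in> carrier_mat m n"
    and P: "P \<in> carrier_mat l m" and Q: "Q \<in> carrier_mat n k"
    and R: "R \<in> carrier_mat k n" and QR: "Q * R = 1\<^sub>m n"
    and Y: "is_solution F G Y"
  shows "is_solution (P * F * Q) (P * G * Q) (\<lambda>t. R *\<^sub>v Y t)"
proof -
  note Yc = is_solution_carrier[OF Y F]
  have key: "P * X * Q *\<^sub>v (R *\<^sub>v v) = P *\<^sub>v (X *\<^sub>v v)"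
    if X: "X \<in> carrier_mat m n" and v: "v \<in> carrier_vec n" for X v
  proof -
    have "P * X * Q *\<^sub>v (R *\<^sub>v v) = P * X *\<^sub>v (Q *\<^sub>v (R *\<^sub>v v))"
      by (rule assoc_mult_mat_vec) (use P X Q R v in auto)
    also have "Q *\<^sub>v (R *\<^sub>v v) = v"
      using assoc_mult_mat_vec[OF Q R v] QR v by simp
    also have "P * X *\<^sub>v v = P *\<^sub>v (X *\<^sub>v v)"
      by (rule assoc_mult_mat_vec) (use P X v in auto)
    finally show ?thesis .
  qed
  have "\<exists>D. has_vec_deriv k (\<lambda>t. R *\<^sub>v Y t) D t \<and> P * F * Q *\<^sub>v D = P * G * Q *\<^sub>v (R *\<^sub>v Y t)" for t
  proof -
    obtain D where D: "has_vec_deriv n Y D t" "F *\<^sub>v D = G *\<^sub>v Y t" by (rule is_solutionE[OF Y F])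
    show ?thesis
      using has_vec_deriv_mult_mat[OF R Yc D(1)] key[OF F has_vec_derivD(1)[OF D(1)]]
        key[OF G Yc[of t]] D(2) by metis
  qed
  then show ?thesis using P F Q R Yc by (auto simp: is_solution_def)
qed

section \<open>Direct sums of systems\<close>

text \<open>The binary step of \<open>diag_block_mat\<close>: every statement about the Kronecker
  form is obtained by splitting off one block at a time. The sizes of the zero blocks are read off
  from A and B, so rectangular and empty blocks fit.\<close>

definition dsum :: "'a :: zero mat \<Rightarrow> 'a mat \<Rightarrow> 'a mat" where
  "dsum A B = four_block_mat A (0\<^sub>m (dim_row A) (dim_col B)) (0\<^sub>m (dim_row B) (dim_col A)) B"

lemma dsum_carrier:
  "A \<in> carrier_mat m n \<Longrightarrow> B \<in> carrier_mat k l \<Longrightarrow> dsum A B \<in> carrier_mat (m + k) (n + l)"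
  by (simp add: dsum_def)

lemma diag_block_mat_Cons_dsum: "diag_block_mat (A # As) = dsum A (diag_block_mat As)"
  by (simp add: dsum_def Let_def)

lemma dsum_mult_vec:
  assumes "A \<in> carrier_mat m n" "B \<in> carrier_mat k l" "a \<in> carrier_vec n" "b \<in> carrier_vec l"
  shows "dsum A B *\<^sub>v (a @\<^sub>v b) = (A *\<^sub>v a) @\<^sub>v (B *\<^sub>v b :: 'a :: comm_ring_1 vec)"
proof -
  have "0\<^sub>m m l *\<^sub>v b = 0\<^sub>v m" "0\<^sub>m k n *\<^sub>v a = 0\<^sub>v k" using assms by auto
  then show ?thesis
    using assms unfolding dsum_def
    by (subst four_block_mat_mult_vec[of _ m n _ l _ k]) auto
qed

lemma is_solution_dsum:
  assumes A: "A1 \<in> carrier_mat m n" "A2 \<in> carrier_mat k l"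
    and B: "B1 \<in> carrier_mat m n" "B2 \<in> carrier_mat k l"
    and Y: "is_solution (dsum A1 A2) (dsum B1 B2) Y"
  shows "is_solution A1 B1 (\<lambda>t. vec_first (Y t) n)"
    and "is_solution A2 B2 (\<lambda>t. vec_last (Y t) l)"
proof -
  note Ac = dsum_carrier[OF A]
  note Yc = is_solution_carrier[OF Y Ac]
  have *: "\<exists>D1 D2. has_vec_deriv n (\<lambda>t. vec_first (Y t) n) D1 t \<and> A1 *\<^sub>v D1 = B1 *\<^sub>v vec_first (Y t) n \<and>
     has_vec_deriv l (\<lambda>t. vec_last (Y t) l) D2 t \<and> A2 *\<^sub>v D2 = B2 *\<^sub>v vec_last (Y t) l" for t
  proof -
    obtain D where D: "has_vec_deriv (n + l) Y D t" "dsum A1 A2 *\<^sub>v D = dsum B1 B2 *\<^sub>v Y t"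
      by (rule is_solutionE[OF Y Ac])
    let ?a = "vec_first D n" and ?b = "vec_last D l"
    let ?c = "vec_first (Y t) n" and ?d = "vec_last (Y t) l"
    have "dsum A1 A2 *\<^sub>v (?a @\<^sub>v ?b) = dsum B1 B2 *\<^sub>v (?c @\<^sub>v ?d)"
      using D(2) Yc has_vec_derivD(1)[OF D(1)] by simp
    then have "(A1 *\<^sub>v ?a) @\<^sub>v (A2 *\<^sub>v ?b) = (B1 *\<^sub>v ?c) @\<^sub>v (B2 *\<^sub>v ?d)"
      by (simp add: dsum_mult_vec[OF A] dsum_mult_vec[OF B])
    then have "A1 *\<^sub>v ?a = B1 *\<^sub>v ?c \<and> A2 *\<^sub>v ?b = B2 *\<^sub>v ?d"
      using A B by (subst (asm) append_vec_eq[of _ m]) auto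
    then show ?thesis using has_vec_deriv_split[OF Yc D(1)] by blast
  qed
  have dims: "dim_col A1 = n" "dim_col A2 = l" using A by auto
  show "is_solution A1 B1 (\<lambda>t. vec_first (Y t) n)"
    unfolding is_solution_def dims using * by (blast intro: vec_first_carrier)
  show "is_solution A2 B2 (\<lambda>t. vec_last (Y t) l)"
    unfolding is_solution_def dims using * by (blast intro: vec_last_carrier)
qed

lemma is_solution_dsumI:
  assumes A: "A1 \<in> carrier_mat m n" "A2 \<in> carrier_mat k l"
    and B: "B1 \<in> carrier_mat m n" "B2 \<in> carrier_mat k l"
    and Y: "is_solution A1 B1 Y" and Z: "is_solution A2 B2 Z"
  shows "is_solution (dsum A1 A2) (dsum B1 B2) (\<lambda>t. Y t @\<^sub>v Z t)"
proof -
  note Yc = is_solution_carrier[OF Y A(1)] and Zc = is_solution_carrier[OF Z A(2)]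
  have "\<exists>D. has_vec_deriv (n + l) (\<lambda>t. Y t @\<^sub>v Z t) D t \<and>
      dsum A1 A2 *\<^sub>v D = dsum B1 B2 *\<^sub>v (Y t @\<^sub>v Z t)" for t
  proof -
    obtain D where D: "has_vec_deriv n Y D t" "A1 *\<^sub>v D = B1 *\<^sub>v Y t" by (rule is_solutionE[OF Y A(1)])
    obtain E where E: "has_vec_deriv l Z E t" "A2 *\<^sub>v E = B2 *\<^sub>v Z t" by (rule is_solutionE[OF Z A(2)])
    show ?thesis
      using has_vec_deriv_append[OF Yc Zc D(1) E(1)] D(2) E(2)
        dsum_mult_vec[OF A has_vec_derivD(1)[OF D(1)] has_vec_derivD(1)[OF E(1)]]
        dsum_mult_vec[OF B Yc[of t] Zc[of t]] by metis
  qed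
  then show ?thesis using dsum_carrier[OF A] Yc Zc
    by (auto simp: is_solution_def)
qed

section \<open>Blocks whose only solution is zero\<close>

text \<open>Says that a block contributes nothing to any solution. It mentions no initial value,
  which makes it stable under direct sums.\<close>

definition rigid :: "complex mat \<Rightarrow> complex mat \<Rightarrow> bool" where
  "rigid A B \<longleftrightarrow> (\<forall>Y. is_solution A B Y \<longrightarrow> (\<forall>t. Y t = 0\<^sub>v (dim_col A)))"

lemma rigid_dsum:
  assumes A: "A1 \<in> carrier_mat m n" "A2 \<in> carrier_mat k l"
    and B: "B1 \<in> carrier_mat m n" "B2 \<in> carrier_mat k l"
    and "rigid A1 B1" "rigid A2 B2"
  shows "rigid (dsum A1 A2) (dsum B1 B2)"
  unfolding rigid_def
proof (intro allI impI)
  fix Y t assume Y: "is_solution (dsum A1 A2) (dsum B1 B2) Y"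
  note sol = is_solution_dsum[OF A B Y]
  have dims: "dim_col A1 = n" "dim_col A2 = l" using A by auto
  have "Y t = vec_first (Y t) n @\<^sub>v vec_last (Y t) l"
    using is_solution_carrier[OF Y dsum_carrier[OF A]] by simp
  also have "\<dots> = 0\<^sub>v n @\<^sub>v 0\<^sub>v l"
    using assms(5)[unfolded rigid_def dims, rule_format, OF sol(1)]
      assms(6)[unfolded rigid_def dims, rule_format, OF sol(2)] by simp
  also have "\<dots> = 0\<^sub>v (dim_col (dsum A1 A2))"
    using dsum_carrier[OF A] by auto
  finally show "Y t = 0\<^sub>v (dim_col (dsum A1 A2))" .
qed

lemma is_solution_zero:
  assumes "A \<in> carrier_mat m n" "B \<in> carrier_mat m n"
  shows "is_solution A B (\<lambda>t. 0\<^sub>v n)"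
proof (rule is_solutionI[OF assms(1), where D = "\<lambda>t. 0\<^sub>v n"])
  show "has_vec_deriv n (\<lambda>t. 0\<^sub>v n) (0\<^sub>v n) t" for t
    by (rule has_vec_derivI) simp_all
qed (use assms in \<open>simp_all add: mult_mat_vec_zero\<close>)

text \<open>The only vector of length 0 is the zero vector. This covers empty lists of blocks as
  well as the zero block with h rows and no columns.\<close>

lemma rigid_no_cols: "A \<in> carrier_mat m 0 \<Longrightarrow> rigid A B"
  unfolding rigid_def is_solution_def by (metis carrier_matD(2) carrier_vecD eq_vecI index_zero_vec(2) not_less_zero)

text \<open>Both nilpotent blocks and blocks of row minimal indices have the last component zero and every
  other component equal to the derivative of the next one.\<close>

lemma zero_of_derivative_chain:
  fixes y :: "nat \<Rightarrow> real \<Rightarrow> complex"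
  assumes last: "\<And>t. 0 < n \<Longrightarrow> y (n - 1) t = 0"
    and step: "\<And>i t. Suc i < n \<Longrightarrow> (y (Suc i) has_vector_derivative y i t) (at t)"
    and i: "i < n"
  shows "y i t = 0"
proof -
  have "k < n \<longrightarrow> (\<forall>t. y (n - 1 - k) t = 0)" for k
  proof (induct k)
    case 0
    then show ?case using last by simp
  next
    case (Suc k)
    show ?case
    proof (intro impI allI)
      fix t assume k: "Suc k < n"
      then have eq: "n - 1 - k = Suc (n - 1 - Suc k)" by simp
      have z: "y (Suc (n - 1 - Suc k)) = (\<lambda>_. 0)" using Suc k eq by auto
      have "((\<lambda>_. 0) has_vector_derivative y (n - 1 - Suc k) t) (at t)"
        using step[of "n - 1 - Suc k" t] k unfolding z by simp
      \<comment> \<open>The zero function has the derivative 0 as well; uniqueness of the Frechet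
        derivative equates the two linear maps, which are then compared at 1.\<close>
      then have "((\<lambda>_::real. 0) has_derivative (\<lambda>x. x *\<^sub>R y (n - 1 - Suc k) t)) (at t)"
        by (simp add: has_vector_derivative_def)
      from has_derivative_unique[OF this has_derivative_const]
      have "(1::real) *\<^sub>R y (n - 1 - Suc k) t = 0" by metis
      then show "y (n - 1 - Suc k) t = 0" by simp
    qed
  qed
  from this[of "n - 1 - i"] i show ?thesis by auto
qed

lemma rigid_nilpotent_block: "rigid (jordan_block n 0) (1\<^sub>m n)"
  unfolding rigid_def
proof (intro allI impI)
  fix Y t assume Y: "is_solution (jordan_block n 0) (1\<^sub>m n) Y"
  have c: "jordan_block n (0::complex) \<in> carrier_mat n n" by simp
  note Yc = is_solution_carrier[OF Y c]
  have *: "\<exists>D. has_vec_deriv n Y D t \<and>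
      (\<forall>i<n. Y t $ i = (if Suc i < n then D $ Suc i else 0))" for t
  proof -
    obtain D where D: "has_vec_deriv n Y D t" "jordan_block n 0 *\<^sub>v D = 1\<^sub>m n *\<^sub>v Y t"
      by (rule is_solutionE[OF Y c])
    have "Y t $ i = (if Suc i < n then D $ Suc i else 0)" if i: "i < n" for i
    proof -
      have "Y t $ i = (jordan_block n 0 *\<^sub>v D) $ i" using D Yc by simp
      also have "\<dots> = (\<Sum>j<n. (if i = j then 0 else if Suc i = j then 1 else 0) * D $ j)"
        by (subst index_mult_mat_vec_sum[OF c has_vec_derivD(1)[OF D(1)] i])
          (use i in \<open>auto intro!: sum.cong\<close>)
      also have "\<dots> = (\<Sum>j<n. if Suc i = j then D $ j else 0)"
        by (intro sum.cong) auto
      also have "\<dots> = (if Suc i < n then D $ Suc i else 0)" by simp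
      finally show ?thesis .
    qed
    with D show ?thesis by blast
  qed
  have "Y t $ i = 0" if i: "i < n" for i
  proof (rule zero_of_derivative_chain[of n "\<lambda>i t. Y t $ i"])
    show "0 < n \<Longrightarrow> Y t $ (n - 1) = 0" for t using *[of t] by auto
    show "((\<lambda>t. Y t $ Suc i) has_vector_derivative Y t $ i) (at t)" if "Suc i < n" for i t
      using *[of t] that has_vec_derivD(2) by (metis Suc_lessD)
  qed (rule i)
  then show "Y t = 0\<^sub>v (dim_col (jordan_block n (0::complex)))"
    using Yc[of t] by (intro eq_vecI) auto
qed

text \<open>Row \<open>Suc i\<close> of the equation reads y_(i+1)' = y_i, and the last row, where
  the left side is zero, reads y_(n-1) = 0. This is the chain of the nilpotent block, moved down by
  one row.\<close>

lemma rigid_row_block: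
  "rigid (transpose_mat (left_id_block n)) (transpose_mat (right_id_block n))"
  unfolding rigid_def
proof (intro allI impI)
  let ?L = "transpose_mat (left_id_block n)" and ?R = "transpose_mat (right_id_block n)"
  fix Y t assume Y: "is_solution ?L ?R Y"
  have [simp]: "(if b then 1 else 0) * x = (if b then x else 0)" for b and x :: complex
    by simp
  have c: "?L \<in> carrier_mat (n + 1) n" "?R \<in> carrier_mat (n + 1) n"
    by (auto simp: left_id_block_def right_id_block_def)
  note Yc = is_solution_carrier[OF Y c(1)]
  have *: "\<exists>D. has_vec_deriv n Y D t \<and>
      (\<forall>i<n. Y t $ i = (if Suc i < n then D $ Suc i else 0))" for t
  proof -
    obtain D where D: "has_vec_deriv n Y D t" "?L *\<^sub>v D = ?R *\<^sub>v Y t"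
      by (rule is_solutionE[OF Y c(1)])
    have "Y t $ i = (if Suc i < n then D $ Suc i else 0)" if i: "i < n" for i
    proof -
      have "(?R *\<^sub>v Y t) $ Suc i = (\<Sum>j<n. (if i = j then Y t $ j else 0))"
        using i by (subst index_mult_mat_vec_sum[OF c(2) Yc])
          (auto intro!: sum.cong simp: right_id_block_def)
      also have "\<dots> = Y t $ i" using i by simp
      finally have 1: "(?R *\<^sub>v Y t) $ Suc i = Y t $ i" .
      have "(?L *\<^sub>v D) $ Suc i = (\<Sum>j<n. (if Suc i = j then D $ j else 0))"
        using i by (subst index_mult_mat_vec_sum[OF c(1) has_vec_derivD(1)[OF D(1)]])
          (auto intro!: sum.cong simp: left_id_block_def)
      then show ?thesis using 1 D(2) by simp
    qed
    with D show ?thesis by blast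
  qed
  have "Y t $ i = 0" if i: "i < n" for i
  proof (rule zero_of_derivative_chain[of n "\<lambda>i t. Y t $ i"])
    show "0 < n \<Longrightarrow> Y t $ (n - 1) = 0" for t using *[of t] by auto
    show "((\<lambda>t. Y t $ Suc i) has_vector_derivative Y t $ i) (at t)" if "Suc i < n" for i t
      using *[of t] that has_vec_derivD(2) by (metis Suc_lessD)
  qed (rule i)
  then show "Y t = 0\<^sub>v (dim_col ?L)"
    using Yc[of t] c by (intro eq_vecI) auto
qed

lemma rigid_nilpotent: "rigid (jordan_matrix (map (\<lambda>n. (n, 0)) qs)) (1\<^sub>m (sum_list qs))"
proof (induct qs)
  case Nil
  show ?case by (rule rigid_no_cols[of _ 0]) (auto simp: jordan_matrix_def)
next
  case (Cons n qs)
  let ?J = "jordan_matrix (map (\<lambda>n. (n, 0)) qs) :: complex mat"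
  have s: "sum_list (map fst (map (\<lambda>n. (n, 0::complex)) qs)) = sum_list qs" by (simp add: comp_def)
  have J: "?J \<in> carrier_mat (sum_list qs) (sum_list qs)"
    using jordan_matrix_carrier[of "map (\<lambda>n. (n, 0::complex)) qs"] unfolding s .
  have 1: "jordan_matrix (map (\<lambda>n. (n, 0::complex)) (n # qs)) = dsum (jordan_block n 0) ?J"
    unfolding list.map(2) jordan_matrix_Cons s using J by (auto simp: dsum_def)
  have 2: "1\<^sub>m (sum_list (n # qs)) = dsum (1\<^sub>m n) (1\<^sub>m (sum_list qs) :: complex mat)"
    by (simp add: dsum_def)
  show ?case unfolding 1 2
    by (rule rigid_dsum[OF jordan_block_carrier J one_carrier_mat one_carrier_mat rigid_nilpotent_block Cons])
qed

lemma diag_block_mat_carrier_map: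
  assumes "\<And>n. f n \<in> carrier_mat (r n) (c n)"
  shows "diag_block_mat (map f ns) \<in> carrier_mat (sum_list (map r ns)) (sum_list (map c ns))"
proof -
  have "dim_row (f n) = r n" "dim_col (f n) = c n" for n using assms[of n] by auto
  then show ?thesis by (intro carrier_matI) (simp_all add: dim_diag_block_mat comp_def)
qed

lemma id_block_carrier:
  "left_id_block n \<in> carrier_mat n (n + 1)" "right_id_block n \<in> carrier_mat n (n + 1)"
  by (auto simp: left_id_block_def right_id_block_def)

lemma rigid_row_blocks:
  "rigid (diag_block_mat (map (\<lambda>n. transpose_mat (left_id_block n)) zs))
     (diag_block_mat (map (\<lambda>n. transpose_mat (right_id_block n)) zs))"
proof (induct zs)
  case Nil
  show ?case by (rule rigid_no_cols[of _ 0]) auto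
next
  case (Cons n zs)
  have c: "diag_block_mat (map (\<lambda>n. transpose_mat (left_id_block n)) zs)
      \<in> carrier_mat (sum_list (map (\<lambda>n. n + 1) zs)) (sum_list (map (\<lambda>n. n) zs))"
    "diag_block_mat (map (\<lambda>n. transpose_mat (right_id_block n)) zs)
      \<in> carrier_mat (sum_list (map (\<lambda>n. n + 1) zs)) (sum_list (map (\<lambda>n. n) zs))"
    by (rule diag_block_mat_carrier_map, simp add: id_block_carrier[simplified])+
  have d: "transpose_mat (left_id_block n) \<in> carrier_mat (n + 1) n"
    "transpose_mat (right_id_block n) \<in> carrier_mat (n + 1) n"
    using id_block_carrier[of n] by simp_all
  show ?case unfolding list.map(2) diag_block_mat_Cons_dsum
    by (rule rigid_dsum[OF d(1) c(1) d(2) c(2) rigid_row_block Cons])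
qed

section \<open>Polynomial null vectors\<close>

text \<open>Stands for a nontrivial right null space over C(s), see
  \<open>dim_right_null_eq_0_iff\<close>. Polynomial entries are demanded so that coefficients can
  be compared and turned into derivatives.\<close>

definition has_poly_null :: "complex mat \<Rightarrow> complex mat \<Rightarrow> bool" where
  "has_poly_null A B \<longleftrightarrow> (\<exists>v \<in> carrier_vec (dim_col A).
     v \<noteq> 0\<^sub>v (dim_col A) \<and> pencil A B *\<^sub>v v = 0\<^sub>v (dim_row A))"

lemma has_poly_nullI:
  assumes "A \<in> carrier_mat m n" "v \<in> carrier_vec n" "v \<noteq> 0\<^sub>v n" "pencil A B *\<^sub>v v = 0\<^sub>v m"
  shows "has_poly_null A B"
proof -
  have "dim_row A = m" "dim_col A = n" using assms(1) by auto
  then show ?thesis using assms(2-4) unfolding has_poly_null_def by blast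
qed

lemma has_poly_nullE:
  assumes "has_poly_null A B" "A \<in> carrier_mat m n"
  obtains v where "v \<in> carrier_vec n" "v \<noteq> 0\<^sub>v n" "pencil A B *\<^sub>v v = 0\<^sub>v m"
proof -
  have "dim_row A = m" "dim_col A = n" using assms(2) by auto
  then show ?thesis using that assms(1) unfolding has_poly_null_def by blast
qed

lemma pencil_carrier:
  "A \<in> carrier_mat m n \<Longrightarrow> B \<in> carrier_mat m n \<Longrightarrow> pencil A B \<in> carrier_mat m n"
  by (auto simp: pencil_def)

lemma index_pencil:
  "A \<in> carrier_mat m n \<Longrightarrow> B \<in> carrier_mat m n \<Longrightarrow> i < m \<Longrightarrow> j < n \<Longrightarrow>
    pencil A B $$ (i, j) = [:- (B $$ (i, j)), A $$ (i, j):]"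
  by (auto simp: pencil_def)

lemma coeff_linear_mult:
  "coeff ([:- b, a:] * q) k = (case k of 0 \<Rightarrow> 0 | Suc l \<Rightarrow> a * coeff q l) - b * coeff q k"
  for a b :: "'a :: comm_ring_1"
  by (simp add: coeff_pCons split: nat.splits)

text \<open>Writing v(s) as the sum of v_k s^k, coefficient k of (sA - B) v(s) is A v_(k-1) - B v_k,
  with v_(-1) = 0. For a null vector this gives B v_0 = 0 and A v_k = B v_(k+1).\<close>

lemma coeff_pencil_mult_vec:
  assumes A: "A \<in> carrier_mat m n" and B: "B \<in> carrier_mat m n" and v: "v \<in> carrier_vec n" and i: "i < m"
  shows "coeff ((pencil A B *\<^sub>v v) $ i) k =
    (case k of 0 \<Rightarrow> 0 | Suc l \<Rightarrow> (\<Sum>j<n. A $$ (i, j) * coeff (v $ j) l)) - (\<Sum>j<n. B $$ (i, j) * coeff (v $ j) k)"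
proof -
  have "coeff ((pencil A B *\<^sub>v v) $ i) k = (\<Sum>j<n. coeff ([:- (B $$ (i, j)), A $$ (i, j):] * v $ j) k)"
    unfolding index_mult_mat_vec_sum[OF pencil_carrier[OF A B] v i] coeff_sum
    by (intro sum.cong refl) (simp only: lessThan_iff index_pencil[OF A B i])
  then show ?thesis by (cases k) (simp_all only: coeff_linear_mult sum_subtractf nat.case, simp_all add: sum_negf)
qed

text \<open>Division by the factorial turns differentiation into a pure shift of the exponent,
  without numerical factors.\<close>

lemma has_vector_derivative_shifted_power:
  "((\<lambda>t. of_real (t - t0) ^ Suc k / fact (Suc k) :: complex) has_vector_derivative
     of_real (t - t0) ^ k / fact k) (at t)"
proof -
  have "((\<lambda>z. z - of_real t0 :: complex) has_field_derivative 1) (at (of_real t))"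
    by (auto intro!: derivative_eq_intros)
  from DERIV_cdivide[OF DERIV_power[OF this, of "Suc k"], of "fact (Suc k)"]
  have "((\<lambda>z. (z - of_real t0) ^ Suc k / fact (Suc k) :: complex) has_field_derivative
     (of_real t - of_real t0) ^ k / fact k) (at (of_real t))"
    by (simp add: fact_Suc del: of_nat_Suc power_Suc)
  from has_vector_derivative_real_field[OF this] show ?thesis by simp
qed

text \<open>If \<open>\<Sum>k. v\<^sub>k s\<^sup>k\<close> is a polynomial null vector, then \<open>\<Sum>k. \<phi>\<^sup>(\<^sup>k\<^sup>) v\<^sub>k\<close> is a solution for every
  smooth scalar \<open>\<phi>\<close>; a high power of \<open>t - t\<^sub>0\<close> makes it vanish at \<open>t\<^sub>0\<close> without vanishing identically.\<close>

lemma nonzero_solution_of_poly_null: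
  assumes A: "A \<in> carrier_mat m n" and B: "B \<in> carrier_mat m n" and "has_poly_null A B"
  shows "\<exists>Y. is_solution A B Y \<and> Y t0 = 0\<^sub>v n \<and> (\<exists>t. Y t \<noteq> 0\<^sub>v n)"
proof -
  obtain v where v: "v \<in> carrier_vec n" "v \<noteq> 0\<^sub>v n" and null: "pencil A B *\<^sub>v v = 0\<^sub>v m"
    using has_poly_nullE[OF assms(3) A] .
  \<comment> \<open>A common bound for the degrees of the entries; a sum avoids a maximum over an
    index set not yet known to be nonempty.\<close>
  define d where "d = (\<Sum>j<n. degree (v $ j))"
  have high: "coeff (v $ j) k = 0" if "j < n" "d < k" for j k
  proof -
    have "degree (v $ j) \<le> d" unfolding d_def
      by (rule member_le_sum) (use that in auto)
    then show ?thesis using that by (simp add: coeff_eq_0)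
  qed
  have zero: "(\<Sum>j<n. B $$ (i, j) * coeff (v $ j) 0) = 0"
    and chain: "(\<Sum>j<n. A $$ (i, j) * coeff (v $ j) k) = (\<Sum>j<n. B $$ (i, j) * coeff (v $ j) (Suc k))"
    if i: "i < m" for i k
    using coeff_pencil_mult_vec[OF A B v(1) i, of 0] coeff_pencil_mult_vec[OF A B v(1) i, of "Suc k"]
    by (simp_all add: null i)
  \<comment> \<open>\<open>\<phi> k\<close> is the k-th derivative of (t - t0)^(d+2) / (d+2)!. For k
    up to d the exponent is at least 2, so everything in \<open>y\<close> vanishes at t0; the
    largest index in \<open>y'\<close> is d + 1, so the subtraction is never truncated.\<close>
  define \<phi> :: "nat \<Rightarrow> real \<Rightarrow> complex" where
    "\<phi> k t = of_real (t - t0) ^ (d + 2 - k) / fact (d + 2 - k)" for k t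
  define y where "y j t = (\<Sum>k\<le>d. coeff (v $ j) k * \<phi> k t)" for j t
  define y' where "y' j t = (\<Sum>k\<le>d. coeff (v $ j) k * \<phi> (Suc k) t)" for j t
  have d\<phi>: "(\<phi> k has_vector_derivative \<phi> (Suc k) t) (at t)" if "k \<le> d" for k t
  proof -
    have "d + 2 - k = Suc (d + 2 - Suc k)" using that by simp
    then show ?thesis unfolding \<phi>_def by (simp only: has_vector_derivative_shifted_power)
  qed
  have dy: "(y j has_vector_derivative y' j t) (at t)" for j t
    unfolding y_def y'_def
    by (intro has_vector_derivative_sum has_vector_derivative_cmult d\<phi>) simp
  define Y where "Y t = vec n (\<lambda>j. y j t)" for t
  define Y' where "Y' t = vec n (\<lambda>j. y' j t)" for t
  have Yc: "Y t \<in> carrier_vec n" "Y' t \<in> carrier_vec n" for t by (simp_all add: Y_def Y'_def)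
  have "is_solution A B Y"
  proof (rule is_solutionI[OF A Yc(1), where D = Y'])
    fix t
    show "has_vec_deriv n Y (Y' t) t"
      by (rule has_vec_derivI[OF Yc(2)]) (simp add: Y_def Y'_def dy)
    show "A *\<^sub>v Y' t = B *\<^sub>v Y t"
    proof (rule eq_vecI)
      fix i assume "i < dim_vec (B *\<^sub>v Y t)"
      then have i: "i < m" using B by simp
      have "(A *\<^sub>v Y' t) $ i = (\<Sum>j<n. A $$ (i, j) * y' j t)"
        unfolding index_mult_mat_vec_sum[OF A Yc(2) i] by (simp add: Y'_def)
      also have "\<dots> = (\<Sum>j<n. \<Sum>k\<le>d. \<phi> (Suc k) t * (A $$ (i, j) * coeff (v $ j) k))"
        by (simp add: y'_def sum_distrib_left mult_ac)
      \<comment> \<open>A v_k is replaced by B v_(k+1). Shifting the index then adds the term k = 0,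
        which is zero by \<open>zero\<close>, and leaves a top term k = d + 1, which is zero by
        \<open>high\<close>.\<close>
      also have "\<dots> = (\<Sum>k\<le>d. \<phi> (Suc k) t * (\<Sum>j<n. B $$ (i, j) * coeff (v $ j) (Suc k)))"
        by (subst sum.swap) (simp add: sum_distrib_left[symmetric] chain[OF i])
      also have "\<dots> = (\<Sum>k\<le>Suc d. \<phi> k t * (\<Sum>j<n. B $$ (i, j) * coeff (v $ j) k))"
        by (subst sum.atMost_Suc_shift) (simp add: zero[OF i])
      also have "\<dots> = (\<Sum>k\<le>d. \<phi> k t * (\<Sum>j<n. B $$ (i, j) * coeff (v $ j) k))"
        by (simp add: high)
      also have "\<dots> = (\<Sum>j<n. \<Sum>k\<le>d. \<phi> k t * (B $$ (i, j) * coeff (v $ j) k))"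
        by (subst sum.swap) (simp add: sum_distrib_left)
      also have "\<dots> = (\<Sum>j<n. B $$ (i, j) * y j t)"
        by (simp add: y_def sum_distrib_left mult_ac)
      also have "\<dots> = (B *\<^sub>v Y t) $ i"
        unfolding index_mult_mat_vec_sum[OF B Yc(1) i] by (simp add: Y_def)
      finally show "(A *\<^sub>v Y' t) $ i = (B *\<^sub>v Y t) $ i" .
    qed (use A B in simp)
  qed
  moreover have "Y t0 = 0\<^sub>v n"
    by (rule eq_vecI) (auto simp: Y_def y_def \<phi>_def intro!: sum.neutral)
  moreover have "\<exists>t. Y t \<noteq> 0\<^sub>v n"
  proof (rule ccontr)
    assume "\<not> ?thesis"
    then have Y0: "Y t = 0\<^sub>v n" for t by blast
    obtain j where j: "j < n" "v $ j \<noteq> 0"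
      using v by (metis carrier_vecD eq_vecI index_zero_vec)
    \<comment> \<open>Component j of Y as a polynomial in t - t0: its coefficients are those of
      \<open>v $ j\<close> in reverse order, divided by factorials, so q = 0 would force
      \<open>v $ j = 0\<close>.\<close>
    define q where "q = (\<Sum>k\<le>d. monom (coeff (v $ j) k / fact (d + 2 - k)) (d + 2 - k))"
    have "poly q (of_real (t - t0)) = 0" for t
    proof -
      have "poly q (of_real (t - t0)) = Y t $ j" using j
        by (simp add: q_def poly_sum poly_monom Y_def y_def \<phi>_def)
      then show ?thesis using Y0 j by simp
    qed
    from this[of "_ + t0"] have "range of_real \<subseteq> {z. poly q z = 0}" by auto
    moreover have "infinite (range (of_real :: real \<Rightarrow> complex))"
      using finite_imageD[of of_real "UNIV :: real set"] infinite_UNIV_char_0 inj_of_real by blast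
    ultimately have "q = 0" using poly_roots_finite finite_subset by blast
    have "coeff (v $ j) l = 0" for l
    proof (cases "l \<le> d")
      case True
      \<comment> \<open>For k and l at most d the exponents d + 2 - k and d + 2 - l agree only if k
        = l.\<close>
      have "coeff q (d + 2 - l) = (\<Sum>k\<le>d. if k = l then coeff (v $ j) k / fact (d + 2 - k) else 0)"
        unfolding q_def coeff_sum by (intro sum.cong) (use True in auto)
      also have "\<dots> = coeff (v $ j) l / fact (d + 2 - l)" using True by simp
      finally show ?thesis using \<open>q = 0\<close> by simp
    qed (use high j in simp)
    then show False using j by (simp add: poly_eq_iff)
  qed
  ultimately show ?thesis by blast
qed

section \<open>Null vectors under direct sums and strict equivalence\<close>

lemma pencil_dsum:
  assumes A: "A1 \<in> carrier_mat m n" "A2 \<in> carrier_mat k l"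
    and B: "B1 \<in> carrier_mat m n" "B2 \<in> carrier_mat k l"
  shows "pencil (dsum A1 A2) (dsum B1 B2) = dsum (pencil A1 B1) (pencil A2 B2)"
  by (rule eq_matI) (use assms in \<open>auto simp: pencil_def dsum_def\<close>)

lemma has_poly_null_dsum:
  assumes A: "A1 \<in> carrier_mat m n" "A2 \<in> carrier_mat k l"
    and B: "B1 \<in> carrier_mat m n" "B2 \<in> carrier_mat k l"
    and null: "has_poly_null A1 B1 \<or> has_poly_null A2 B2"
  shows "has_poly_null (dsum A1 A2) (dsum B1 B2)"
proof -
  note c = dsum_carrier[OF A]
  \<comment> \<open>Treats both alternatives at once: the null vector of one block is padded with
    the zero vector in the other.\<close>
  have *: ?thesis if v: "v \<in> carrier_vec n" "pencil A1 B1 *\<^sub>v v = 0\<^sub>v m"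
    and w: "w \<in> carrier_vec l" "pencil A2 B2 *\<^sub>v w = 0\<^sub>v k" and ne: "v \<noteq> 0\<^sub>v n \<or> w \<noteq> 0\<^sub>v l" for v w
  proof -
    have "v @\<^sub>v w \<in> carrier_vec (n + l)" using v w by simp
    moreover have "v @\<^sub>v w \<noteq> 0\<^sub>v (n + l)"
    proof
      assume "v @\<^sub>v w = 0\<^sub>v (n + l)"
      then have "v @\<^sub>v w = 0\<^sub>v n @\<^sub>v 0\<^sub>v l" by (simp add: append_zero_vec)
      with v ne show False by (subst (asm) append_vec_eq[of _ n]) auto
    qed
    moreover have "pencil (dsum A1 A2) (dsum B1 B2) *\<^sub>v (v @\<^sub>v w) = 0\<^sub>v (m + k)"
      unfolding pencil_dsum[OF A B]
      using dsum_mult_vec[OF pencil_carrier[OF A(1) B(1)] pencil_carrier[OF A(2) B(2)] v(1) w(1)] v w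
      by (simp add: append_zero_vec)
    ultimately show ?thesis by (rule has_poly_nullI[OF c])
  qed
  from null show ?thesis
  proof
    assume null1: "has_poly_null A1 B1"
    obtain v where "v \<in> carrier_vec n" "v \<noteq> 0\<^sub>v n" "pencil A1 B1 *\<^sub>v v = 0\<^sub>v m"
      using has_poly_nullE[OF null1 A(1)] .
    then show ?thesis using *[of v "0\<^sub>v l"] mult_mat_vec_zero[OF pencil_carrier[OF A(2) B(2)]] by simp
  next
    assume null2: "has_poly_null A2 B2"
    obtain w where "w \<in> carrier_vec l" "w \<noteq> 0\<^sub>v l" "pencil A2 B2 *\<^sub>v w = 0\<^sub>v k"
      using has_poly_nullE[OF null2 A(2)] .
    then show ?thesis using *[of "0\<^sub>v n" w] mult_mat_vec_zero[OF pencil_carrier[OF A(1) B(1)]] by simp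
  qed
qed

interpretation const_poly: inj_comm_ring_hom "\<lambda>c :: complex. [:c:]"
  by unfold_locales (auto simp: one_pCons)

text \<open>P and Q do not involve s, so they pass through the scalar factor s and distribute over
  the difference.\<close>

lemma pencil_transform:
  assumes F: "F \<in> carrier_mat m n" and G: "G \<in> carrier_mat m n"
    and P: "P \<in> carrier_mat l m" and Q: "Q \<in> carrier_mat n k"
  shows "pencil (P * F * Q) (P * G * Q)
    = map_mat (\<lambda>c. [:c:]) P * pencil F G * map_mat (\<lambda>c. [:c:]) Q"
proof -
  define h :: "complex mat \<Rightarrow> complex poly mat" where "h = map_mat (\<lambda>c. [:c:])"
  have c: "h P \<in> carrier_mat l m" "h F \<in> carrier_mat m n" "h G \<in> carrier_mat m n"
    "h Q \<in> carrier_mat n k" using assms by (auto simp: h_def)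
  have hom: "h (P * X * Q) = h P * h X * h Q" if X: "X \<in> carrier_mat m n" for X
    unfolding h_def using const_poly.mat_hom_mult[OF mult_carrier_mat[OF P X] Q]
      const_poly.mat_hom_mult[OF P X] by simp
  have sF: "[:0, 1:] \<cdot>\<^sub>m h F \<in> carrier_mat m n" using c by simp
  have "h P * ([:0, 1:] \<cdot>\<^sub>m h F - h G) * h Q = (h P * ([:0, 1:] \<cdot>\<^sub>m h F) - h P * h G) * h Q"
    by (subst mult_minus_distrib_mat[OF c(1) sF c(3)]) simp
  also have "\<dots> = h P * ([:0, 1:] \<cdot>\<^sub>m h F) * h Q - h P * h G * h Q"
    by (rule minus_mult_distrib_mat[OF mult_carrier_mat[OF c(1) sF] mult_carrier_mat[OF c(1,3)] c(4)])
  also have "h P * ([:0, 1:] \<cdot>\<^sub>m h F) * h Q = [:0, 1:] \<cdot>\<^sub>m (h P * h F * h Q)"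
    unfolding mult_smult_distrib[OF c(1,2)]
    by (rule mult_smult_assoc_mat[OF mult_carrier_mat[OF c(1,2)] c(4)])
  finally show ?thesis
    unfolding pencil_def h_def[symmetric] hom[OF F] hom[OF G] by (rule sym)
qed

text \<open>A null vector v of the transformed pencil gives the null vector Q v of the original:
  P^-1 removes the factor P, and Q^-1 recovers v from Q v, which is therefore nonzero. This carries
  null vectors from the Kronecker form to F and G.\<close>

lemma has_poly_null_transform:
  assumes F: "F \<in> carrier_mat m n" and G: "G \<in> carrier_mat m n"
    and P: "P \<in> carrier_mat m m" "P' \<in> carrier_mat m m" "P' * P = 1\<^sub>m m"
    and Q: "Q \<in> carrier_mat n n" "Q' \<in> carrier_mat n n" "Q' * Q = 1\<^sub>m n"
    and null: "has_poly_null (P * F * Q) (P * G * Q)"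
  shows "has_poly_null F G"
proof -
  define h :: "complex mat \<Rightarrow> complex poly mat" where "h = map_mat (\<lambda>c. [:c:])"
  have c: "h P \<in> carrier_mat m m" "h P' \<in> carrier_mat m m"
    "h Q \<in> carrier_mat n n" "h Q' \<in> carrier_mat n n" using P Q by (auto simp: h_def)
  have inv: "h P' * h P = 1\<^sub>m m" "h Q' * h Q = 1\<^sub>m n"
    using const_poly.mat_hom_mult[OF P(2,1)] const_poly.mat_hom_mult[OF Q(2,1)] P Q
    by (simp_all add: const_poly.mat_hom_one h_def)
  define K where "K = pencil F G"
  have K: "K \<in> carrier_mat m n" using pencil_carrier[OF F G] by (simp add: K_def)
  have dims: "dim_col (P * F * Q) = n" "dim_row (P * F * Q) = m" using P(1) Q(1) by simp_all
  have "\<exists>v \<in> carrier_vec n. v \<noteq> 0\<^sub>v n \<and> h P * K * h Q *\<^sub>v v = 0\<^sub>v m"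
    using null unfolding has_poly_null_def dims pencil_transform[OF F G P(1) Q(1)] h_def K_def .
  then obtain v where v: "v \<in> carrier_vec n" "v \<noteq> 0\<^sub>v n" "h P * K * h Q *\<^sub>v v = 0\<^sub>v m" by blast
  define w where "w = h Q *\<^sub>v v"
  have w: "w \<in> carrier_vec n" unfolding w_def using c(3) v(1) by (rule mult_mat_vec_carrier)
  have "h Q' *\<^sub>v w = v"
    unfolding w_def using v inv assoc_mult_mat_vec[OF c(4,3) v(1)] by simp
  then have "w \<noteq> 0\<^sub>v n" using v(2) mult_mat_vec_zero[OF c(4)] by metis
  moreover have "K *\<^sub>v w = 0\<^sub>v m"
  proof -
    have Kw: "K *\<^sub>v w \<in> carrier_vec m" using K w by simp
    have "h P *\<^sub>v (K *\<^sub>v w) = h P * K *\<^sub>v w"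
      using assoc_mult_mat_vec[OF c(1) K w] by simp
    also have "\<dots> = 0\<^sub>v m" unfolding w_def
      using assoc_mult_mat_vec[OF mult_carrier_mat[OF c(1) K] c(3) v(1)] v(3) by simp
    finally have "h P' *\<^sub>v (h P *\<^sub>v (K *\<^sub>v w)) = 0\<^sub>v m" using mult_mat_vec_zero[OF c(2)] by simp
    then show ?thesis
      using assoc_mult_mat_vec[OF c(2,1) Kw] inv Kw by simp
  qed
  ultimately show ?thesis unfolding K_def by (rule has_poly_nullI[OF F w])
qed

section \<open>From rational to polynomial null vectors\<close>

text \<open>The product of the denominators of chosen representatives serves, built up one factor at
  a time.\<close>

lemma common_denominator:
  fixes x :: "nat \<Rightarrow> 'a :: idom fract"
  shows "\<exists>m. m \<noteq> 0 \<and> (\<forall>i<n. \<exists>c. to_fract m * x i = to_fract c)"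
proof (induct n)
  case 0
  show ?case by (rule exI[of _ 1]) simp
next
  case (Suc n)
  then obtain m where m: "m \<noteq> 0" "\<And>i. i < n \<Longrightarrow> \<exists>c. to_fract m * x i = to_fract c" by blast
  obtain a b where ab: "x n = Fract a b" "b \<noteq> 0" by (cases "x n") auto
  have "\<exists>c. to_fract (m * b) * x i = to_fract c" if i: "i < Suc n" for i
  proof (cases "i = n")
    case True
    then have "to_fract (m * b) * x i = to_fract (m * a)"
      using ab by (simp add: Fract_conv_to_fract)
    then show ?thesis ..
  next
    case False
    then obtain c where "to_fract m * x i = to_fract c" using m(2)[of i] i by auto
    then have "to_fract (m * b) * x i = to_fract (c * b)" by (metis mult.commute mult.left_commute to_fract_mult)
    then show ?thesis ..
  qed
  then show ?case using m(1) ab(2) by (intro exI[of _ "m * b"]) simp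
qed

text \<open>Goes through bases of the kernel: dimension 0 means that a basis is empty and hence
  spans only the zero vector; conversely the empty set is a basis of a trivial kernel.\<close>

lemma kernel_dim_eq_0_iff:
  fixes A :: "'a :: field mat"
  assumes A: "A \<in> carrier_mat nr nc"
  shows "kernel_dim A = 0 \<longleftrightarrow> (\<forall>v \<in> carrier_vec nc. A *\<^sub>v v = 0\<^sub>v nr \<longrightarrow> v = 0\<^sub>v nc)"
proof -
  interpret kernel nr nc A by unfold_locales (rule A)
  have span: "span {} = {0\<^sub>v nc}" using Ker.span_empty by simp
  have z: "0\<^sub>v nc \<in> mat_kernel A" using mult_mat_vec_zero[OF A] by (intro mat_kernelI[OF A]) auto
  have "dim = 0 \<longleftrightarrow> mat_kernel A \<subseteq> {0\<^sub>v nc}"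
  proof
    assume d: "dim = 0"
    obtain bas where "finite bas" "basis bas" using kernel_basis_exists[OF A] by auto
    then have "bas = {}" using Ker.dim_basis[of bas] d by simp
    then show "mat_kernel A \<subseteq> {0\<^sub>v nc}" using \<open>basis bas\<close> span by (simp add: Ker.basis_def)
  next
    assume e: "mat_kernel A \<subseteq> {0\<^sub>v nc}"
    have "lin_indpt {}" unfolding Ker.lin_dep_def by blast
    moreover have "{0\<^sub>v nc} = mat_kernel A"
      by (rule equalityI[OF _ e], rule subsetI, drule singletonD, simp only: z)
    then have "span {} = mat_kernel A" using span by metis
    ultimately have "basis {}" unfolding Ker.basis_def by simp
    then show "dim = 0" using Ker.dim_basis[of "{}"] by simp
  qed
  then have "kernel_dim A = 0 \<longleftrightarrow> mat_kernel A \<subseteq> {0\<^sub>v nc}" by (simp only: kernel_dim)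
  also have "\<dots> \<longleftrightarrow> (\<forall>v \<in> carrier_vec nc. A *\<^sub>v v = 0\<^sub>v nr \<longrightarrow> v = 0\<^sub>v nc)"
    unfolding mat_kernel[OF A] by blast
  finally show ?thesis .
qed

interpretation frac: inj_comm_ring_hom "to_fract :: complex poly \<Rightarrow> complex poly fract"
  by unfold_locales auto

text \<open>Embedding C[s] into C(s) is injective, so polynomial null vectors stay nonzero; in the
  other direction, multiplication by a nonzero common denominator preserves both nullity and
  nonvanishing.\<close>

lemma dim_right_null_eq_0_iff:
  assumes F: "F \<in> carrier_mat m n" and G: "G \<in> carrier_mat m n"
  shows "dim_right_null F G = 0 \<longleftrightarrow> \<not> has_poly_null F G"
proof -
  note K = pencil_carrier[OF F G]
  have R: "rat_pencil F G \<in> carrier_mat m n" using K by (simp add: rat_pencil_def)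
  have hom: "rat_pencil F G *\<^sub>v map_vec to_fract v = map_vec to_fract (pencil F G *\<^sub>v v)"
    if "v \<in> carrier_vec n" for v
    unfolding rat_pencil_def by (rule frac.mult_mat_vec_hom[OF K that, symmetric])
  have "has_poly_null F G \<longleftrightarrow> (\<exists>v \<in> carrier_vec n. rat_pencil F G *\<^sub>v v = 0\<^sub>v m \<and> v \<noteq> 0\<^sub>v n)"
  proof
    assume null: "has_poly_null F G"
    obtain v where "v \<in> carrier_vec n" "v \<noteq> 0\<^sub>v n" "pencil F G *\<^sub>v v = 0\<^sub>v m"
      using has_poly_nullE[OF null F] .
    then show "\<exists>v \<in> carrier_vec n. rat_pencil F G *\<^sub>v v = 0\<^sub>v m \<and> v \<noteq> 0\<^sub>v n"
      by (intro bexI[of _ "map_vec to_fract v"]) (simp_all add: hom frac.vec_hom_zero)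
  next
    assume "\<exists>v \<in> carrier_vec n. rat_pencil F G *\<^sub>v v = 0\<^sub>v m \<and> v \<noteq> 0\<^sub>v n"
    then obtain x where x: "x \<in> carrier_vec n" "rat_pencil F G *\<^sub>v x = 0\<^sub>v m" "x \<noteq> 0\<^sub>v n" by blast
    obtain d where d: "d \<noteq> 0" "\<forall>i<n. \<exists>c. to_fract d * x $ i = to_fract c"
      using common_denominator[of n "\<lambda>i. x $ i"] by blast
    then obtain c where c: "\<And>i. i < n \<Longrightarrow> to_fract d * x $ i = to_fract (c i)" by metis
    have eq: "map_vec to_fract (vec n c) = to_fract d \<cdot>\<^sub>v x"
      using x by (intro eq_vecI) (auto simp: c)
    have "map_vec to_fract (pencil F G *\<^sub>v vec n c) = rat_pencil F G *\<^sub>v (to_fract d \<cdot>\<^sub>v x)"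
      unfolding hom[OF vec_carrier, symmetric] eq ..
    also have "\<dots> = 0\<^sub>v m" using mult_mat_vec[OF R x(1)] x(2) by (simp add: smult_zero_vec_ring)
    finally have "pencil F G *\<^sub>v vec n c = 0\<^sub>v m" unfolding frac.vec_hom_zero_iff .
    moreover have "vec n c \<noteq> 0\<^sub>v n"
    proof
      assume c0: "vec n c = 0\<^sub>v n"
      have z: "to_fract d \<cdot>\<^sub>v x = 0\<^sub>v n"
        using eq unfolding c0 frac.vec_hom_zero by (rule sym)
      have "x = 0\<^sub>v n"
      proof (rule eq_vecI)
        show "dim_vec x = dim_vec (0\<^sub>v n)" using x(1) by simp
        fix i assume "i < dim_vec (0\<^sub>v n)"
        then have i: "i < n" by simp
        have "to_fract d * x $ i = (to_fract d \<cdot>\<^sub>v x) $ i" using x(1) i by simp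
        also have "\<dots> = 0" unfolding z using i by simp
        finally show "x $ i = 0\<^sub>v n $ i" using d(1) i by simp
      qed
      then show False using x(3) by contradiction
    qed
    ultimately show "has_poly_null F G" by (intro has_poly_nullI[OF F vec_carrier])
  qed
  then show ?thesis unfolding dim_right_null_def kernel_dim_eq_0_iff[OF R] by blast
qed

text \<open>Row i of the pencil has s in column i and -1 in column i + 1, so it maps the vector of
  powers to s s^i - s^(i+1) = 0.\<close>

lemma has_poly_null_column_block: "has_poly_null (left_id_block e) (right_id_block e)"
proof -
  define v :: "complex poly vec" where "v = vec (e + 1) (\<lambda>j. monom 1 j)"
  have vc: "v \<in> carrier_vec (e + 1)" by (simp add: v_def)
  have "v $ 0 = 1" by (simp add: v_def)
  then have "v \<noteq> 0\<^sub>v (e + 1)" by auto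
  moreover have "pencil (left_id_block e) (right_id_block e) *\<^sub>v v = 0\<^sub>v e"
  proof (rule eq_vecI)
    note c = id_block_carrier[of e]
    fix i assume "i < dim_vec (0\<^sub>v e :: complex poly vec)"
    then have i: "i < e" by simp
    have "coeff ((pencil (left_id_block e) (right_id_block e) *\<^sub>v v) $ i) k = 0" for k
    proof -
      have l: "(\<Sum>j<e + 1. left_id_block e $$ (i, j) * coeff (v $ j) l) = (if l = i then 1 else 0)" for l
      proof -
        have "(\<Sum>j<e + 1. left_id_block e $$ (i, j) * coeff (v $ j) l)
          = (\<Sum>j<e + 1. if i = j then (if l = i then 1 else 0) else 0)"
          using i by (intro sum.cong) (auto simp: left_id_block_def v_def)
        then show ?thesis using i by simp
      qed
      have r: "(\<Sum>j<e + 1. right_id_block e $$ (i, j) * coeff (v $ j) l) = (if l = Suc i then 1 else 0)" for l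
      proof -
        have "(\<Sum>j<e + 1. right_id_block e $$ (i, j) * coeff (v $ j) l)
          = (\<Sum>j<e + 1. if Suc i = j then (if l = Suc i then 1 else 0) else 0)"
          using i by (intro sum.cong) (auto simp: right_id_block_def v_def)
        then show ?thesis using i by simp
      qed
      show ?thesis
        unfolding coeff_pencil_mult_vec[OF c vc i] l r by (simp split: nat.splits)
    qed
    then show "(pencil (left_id_block e) (right_id_block e) *\<^sub>v v) $ i = 0\<^sub>v e $ i"
      using i by (simp add: poly_eq_iff)
  qed (use pencil_carrier[OF id_block_carrier, of e] in simp)
  ultimately show ?thesis by (rule has_poly_nullI[OF id_block_carrier(1) vc])
qed

text \<open>The case of zero column minimal indices: every vector is null, and g > 0 supplies a
  nonzero one.\<close>

lemma has_poly_null_zero_block: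
  assumes g: "g > 0"
  shows "has_poly_null (0\<^sub>m h g) (0\<^sub>m h g)"
proof -
  define u :: "complex poly vec" where "u = unit_vec g 0"
  have u: "u \<in> carrier_vec g" "u $ 0 = 1" using g by (simp_all add: u_def)
  have "u \<noteq> 0\<^sub>v g" using u(2) g by auto
  moreover have "pencil (0\<^sub>m h g) (0\<^sub>m h g) = 0\<^sub>m h g"
    by (rule eq_matI) (auto simp: pencil_def)
  then have "pencil (0\<^sub>m h g) (0\<^sub>m h g) *\<^sub>v u = 0\<^sub>v h"
    using u(1) by (intro eq_vecI) (auto simp: scalar_prod_def)
  ultimately show ?thesis by (rule has_poly_nullI[OF zero_carrier_mat u(1)])
qed

section \<open>The matrix exponential\<close>

lemma smult_pow_mat:
  assumes "A \<in> carrier_mat n n"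
  shows "(c \<cdot>\<^sub>m A) ^\<^sub>m k = c ^ k \<cdot>\<^sub>m (A ^\<^sub>m k :: 'a :: comm_ring_1 mat)"
proof (induct k)
  case 0
  show ?case by (rule eq_matI) auto
next
  case (Suc k)
  have p: "A ^\<^sub>m k \<in> carrier_mat n n" using assms by simp
  have "(c \<cdot>\<^sub>m A) ^\<^sub>m Suc k = (c ^ k \<cdot>\<^sub>m A ^\<^sub>m k) * (c \<cdot>\<^sub>m A)" by (simp add: Suc)
  also have "\<dots> = c ^ Suc k \<cdot>\<^sub>m (A ^\<^sub>m k * A)"
    unfolding mult_smult_distrib[OF smult_carrier_mat[OF p] assms] mult_smult_assoc_mat[OF p assms]
    by (rule eq_matI) (auto simp: mult_ac)
  finally show ?case by simp
qed

text \<open>\<open>pow_mat\<close> unfolds with the new factor on the right; the left version is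
  what yields the derivative in the form A exp(zA).\<close>

lemma pow_mat_Suc_left:
  assumes "A \<in> carrier_mat n n"
  shows "A ^\<^sub>m Suc k = A * A ^\<^sub>m k"
proof (induct k)
  case 0
  show ?case using assms by simp
next
  case (Suc k)
  have "A ^\<^sub>m Suc (Suc k) = A ^\<^sub>m Suc k * A" by simp
  also have "\<dots> = A * A ^\<^sub>m k * A" by (simp only: Suc)
  also have "\<dots> = A * (A ^\<^sub>m k * A)"
    by (rule assoc_mult_mat) (use assms in auto)
  finally show ?case by simp
qed

lemma index_mult_mat_sum:
  assumes "A \<in> carrier_mat m n" "B \<in> carrier_mat n k" "i < m" "j < k"
  shows "(A * B) $$ (i, j) = (\<Sum>l<n. A $$ (i, l) * B $$ (l, j))"
  using assms by (auto simp: scalar_prod_def atLeast0LessThan intro!: sum.cong)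

text \<open>One more factor A contributes at most a column sum of absolute values, which the sum
  over all entries bounds. The geometric bound permits comparison with a scalar exponential
  series.\<close>

lemma norm_pow_mat_le:
  fixes A :: "complex mat"
  assumes A: "A \<in> carrier_mat n n" and ij: "i < n" "j < n"
  shows "norm ((A ^\<^sub>m k) $$ (i, j)) \<le> (\<Sum>l<n. \<Sum>j<n. norm (A $$ (l, j))) ^ k"
  using ij
proof (induct k arbitrary: i j)
  case 0
  then show ?case using A by simp
next
  case (Suc k)
  let ?B = "\<Sum>l<n. \<Sum>j<n. norm (A $$ (l, j))"
  have p: "A ^\<^sub>m k \<in> carrier_mat n n" using A by simp
  have B: "0 \<le> ?B" by (intro sum_nonneg) simp
  have "norm ((A ^\<^sub>m Suc k) $$ (i, j)) \<le> (\<Sum>l<n. norm ((A ^\<^sub>m k) $$ (i, l) * A $$ (l, j)))"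
    unfolding pow_mat.simps(2) index_mult_mat_sum[OF p A Suc.prems] by (rule norm_sum)
  also have "\<dots> \<le> (\<Sum>l<n. ?B ^ k * norm (A $$ (l, j)))"
    unfolding norm_mult by (intro sum_mono mult_right_mono Suc.hyps Suc.prems) auto
  also have "\<dots> = ?B ^ k * (\<Sum>l<n. norm (A $$ (l, j)))" by (simp add: sum_distrib_left)
  also have "\<dots> \<le> ?B ^ k * ?B"
    using Suc.prems B by (intro mult_left_mono sum_mono member_le_sum zero_le_power) auto
  finally show ?case by (simp add: mult.commute)
qed

lemma summable_exp_coeffs:
  fixes A :: "complex mat"
  assumes A: "A \<in> carrier_mat n n" and ij: "i < n" "j < n"
  shows "summable (\<lambda>k. (A ^\<^sub>m k) $$ (i, j) / fact k * z ^ k)"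
proof -
  let ?B = "\<Sum>l<n. \<Sum>j<n. norm (A $$ (l, j))"
  have "summable (\<lambda>k. inverse (fact k) * (?B * norm z) ^ k)" by (rule summable_exp)
  then show ?thesis
  proof (rule summable_comparison_test')
    fix k
    show "norm ((A ^\<^sub>m k) $$ (i, j) / fact k * z ^ k) \<le> inverse (fact k) * (?B * norm z) ^ k"
      using mult_right_mono[OF norm_pow_mat_le[OF A ij], of "norm z ^ k / fact k" k]
      by (simp add: norm_mult norm_divide norm_power power_mult_distrib field_simps)
  qed
qed

lemma suminf_sum_mult_left:
  fixes c :: "nat \<Rightarrow> complex"
  assumes "\<And>l. l < n \<Longrightarrow> summable (f l)"
  shows "(\<Sum>k. \<Sum>l<n. c l * f l k) = (\<Sum>l<n. c l * (\<Sum>k. f l k))"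
proof -
  have "(\<Sum>k. \<Sum>l<n. c l * f l k) = (\<Sum>l<n. \<Sum>k. c l * f l k)"
    by (rule suminf_sum) (simp add: assms summable_mult)
  also have "\<dots> = (\<Sum>l<n. c l * (\<Sum>k. f l k))"
    by (intro sum.cong refl suminf_mult) (simp add: assms)
  finally show ?thesis .
qed

text \<open>Exhibits each entry of exp(zA) as a power series in the single complex variable z, to
  which termwise differentiation applies.\<close>

lemma index_mat_exp_smult:
  assumes A: "A \<in> carrier_mat n n" and ij: "i < n" "j < n"
  shows "mat_exp (z \<cdot>\<^sub>m A) $$ (i, j) = (\<Sum>k. (A ^\<^sub>m k) $$ (i, j) / fact k * z ^ k)"
  using assms by (simp add: mat_exp_def smult_pow_mat[OF A] mult_ac)

lemma mat_exp_carrier: "A \<in> carrier_mat n n \<Longrightarrow> mat_exp A \<in> carrier_mat n n"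
  by (auto simp: mat_exp_def)

lemma mat_exp_zero:
  assumes A: "A \<in> carrier_mat n n"
  shows "mat_exp (0 \<cdot>\<^sub>m A) = 1\<^sub>m n"
proof (rule eq_matI)
  fix i j assume "i < dim_row (1\<^sub>m n :: complex mat)" "j < dim_col (1\<^sub>m n :: complex mat)"
  then have ij: "i < n" "j < n" by simp_all
  show "mat_exp (0 \<cdot>\<^sub>m A) $$ (i, j) = 1\<^sub>m n $$ (i, j)"
    unfolding index_mat_exp_smult[OF A ij] powser_zero using A by simp
qed (use mat_exp_carrier[of "0 \<cdot>\<^sub>m A" n] A in auto)

text \<open>The two forms come from splitting the power k + 1 of A on the left or on the right. The
  first shows that the flow solves the equation, the second is needed when the flow runs
  backwards.\<close>

lemma has_field_derivative_mat_exp: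
  assumes A: "A \<in> carrier_mat n n" and ij: "i < n" "j < n"
  shows "((\<lambda>z. mat_exp (z \<cdot>\<^sub>m A) $$ (i, j)) has_field_derivative (A * mat_exp (z \<cdot>\<^sub>m A)) $$ (i, j)) (at z)"
    and "((\<lambda>z. mat_exp (z \<cdot>\<^sub>m A) $$ (i, j)) has_field_derivative (mat_exp (z \<cdot>\<^sub>m A) * A) $$ (i, j)) (at z)"
proof -
  let ?a = "\<lambda>i j k. (A ^\<^sub>m k) $$ (i, j) / fact k"
  have p: "A ^\<^sub>m k \<in> carrier_mat n n" for k using A by simp
  have E: "mat_exp (z \<cdot>\<^sub>m A) \<in> carrier_mat n n" using A by (simp add: mat_exp_carrier)
  \<comment> \<open>\<open>diffs\<close> multiplies coefficient k + 1 by k + 1, which reduces the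
    factorial of k + 1 to that of k.\<close>
  have d: "diffs (?a i j) = (\<lambda>k. (A ^\<^sub>m Suc k) $$ (i, j) / fact k)"
    by (rule ext) (simp add: diffs_def fact_Suc del: of_nat_Suc pow_mat.simps)
  have der: "((\<lambda>z. mat_exp (z \<cdot>\<^sub>m A) $$ (i, j)) has_field_derivative
      (\<Sum>k. (A ^\<^sub>m Suc k) $$ (i, j) / fact k * z ^ k)) (at z)"
    unfolding index_mat_exp_smult[OF A ij]
    using termdiffs_strong_converges_everywhere[OF summable_exp_coeffs[OF A ij], of z] unfolding d .
  have "(\<Sum>k. (A ^\<^sub>m Suc k) $$ (i, j) / fact k * z ^ k) = (\<Sum>k. \<Sum>l<n. A $$ (i, l) * (?a l j k * z ^ k))"
    unfolding pow_mat_Suc_left[OF A] index_mult_mat_sum[OF A p ij] sum_divide_distrib sum_distrib_right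
    by (simp add: mult_ac)
  also have "\<dots> = (\<Sum>l<n. A $$ (i, l) * (\<Sum>k. ?a l j k * z ^ k))"
    by (rule suminf_sum_mult_left) (rule summable_exp_coeffs[OF A _ ij(2)])
  also have "\<dots> = (A * mat_exp (z \<cdot>\<^sub>m A)) $$ (i, j)"
    unfolding index_mult_mat_sum[OF A E ij]
    by (intro sum.cong refl) (simp only: lessThan_iff index_mat_exp_smult[OF A _ ij(2)])
  finally show "((\<lambda>z. mat_exp (z \<cdot>\<^sub>m A) $$ (i, j)) has_field_derivative (A * mat_exp (z \<cdot>\<^sub>m A)) $$ (i, j)) (at z)"
    using der by simp
  have "(\<Sum>k. (A ^\<^sub>m Suc k) $$ (i, j) / fact k * z ^ k) = (\<Sum>k. \<Sum>l<n. A $$ (l, j) * (?a i l k * z ^ k))"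
    unfolding pow_mat.simps(2) index_mult_mat_sum[OF p A ij] sum_divide_distrib sum_distrib_right
    by (simp add: mult_ac)
  also have "\<dots> = (\<Sum>l<n. A $$ (l, j) * (\<Sum>k. ?a i l k * z ^ k))"
    by (rule suminf_sum_mult_left) (rule summable_exp_coeffs[OF A ij(1)])
  also have "\<dots> = (mat_exp (z \<cdot>\<^sub>m A) * A) $$ (i, j)"
    unfolding index_mult_mat_sum[OF E A ij]
    by (intro sum.cong refl) (simp only: lessThan_iff index_mat_exp_smult[OF A ij(1)] mult.commute)
  finally show "((\<lambda>z. mat_exp (z \<cdot>\<^sub>m A) $$ (i, j)) has_field_derivative (mat_exp (z \<cdot>\<^sub>m A) * A) $$ (i, j)) (at z)"
    using der by simp
qed

lemma constant_of_zero_vector_derivative: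
  fixes f :: "real \<Rightarrow> complex"
  assumes "\<And>t. (f has_vector_derivative 0) (at t)"
  shows "f s = f t"
  using DERIV_isconst_all[of "\<lambda>x. Re (f x)" s t] DERIV_isconst_all[of "\<lambda>x. Im (f x)" s t] assms
  by (auto simp: has_vector_derivative_complex_iff intro: complex_eqI)

section \<open>The initial value problem Z' = A Z\<close>

text \<open>The propagator from time \<open>t0\<close> to time \<open>t\<close>; exchanging the two
  times gives the propagator back.\<close>

abbreviation (input) flow :: "complex mat \<Rightarrow> real \<Rightarrow> real \<Rightarrow> complex mat" where
  "flow A t0 t \<equiv> mat_exp (complex_of_real (t - t0) \<cdot>\<^sub>m A)"

lemma is_solution_flow:
  assumes A: "A \<in> carrier_mat n n" and z: "z \<in> carrier_vec n"
  shows "is_solution (1\<^sub>m n) A (\<lambda>t. flow A t0 t *\<^sub>v z)"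
proof -
  have E: "flow A t0 t \<in> carrier_mat n n" for t using A by (simp add: mat_exp_carrier)
  have Ez: "flow A t0 t *\<^sub>v z \<in> carrier_vec n" for t using E z by (rule mult_mat_vec_carrier)
  have AEz: "A *\<^sub>v (flow A t0 t *\<^sub>v z) \<in> carrier_vec n" for t using A Ez by (rule mult_mat_vec_carrier)
  show ?thesis
  proof (rule is_solutionI[OF one_carrier_mat Ez, where D = "\<lambda>t. A *\<^sub>v (flow A t0 t *\<^sub>v z)"])
    fix t
    show "1\<^sub>m n *\<^sub>v (A *\<^sub>v (flow A t0 t *\<^sub>v z)) = A *\<^sub>v (flow A t0 t *\<^sub>v z)"
      using AEz by (rule one_mult_mat_vec)
    show "has_vec_deriv n (\<lambda>t. flow A t0 t *\<^sub>v z) (A *\<^sub>v (flow A t0 t *\<^sub>v z)) t"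
    proof (rule has_vec_derivI[OF AEz])
      fix i assume i: "i < n"
      have "((\<lambda>s. flow A t0 s $$ (i, j)) has_vector_derivative (A * flow A t0 t) $$ (i, j)) (at t)"
        if j: "j < n" for j
      proof -
        \<comment> \<open>The derivative is taken in a complex variable w and then restricted to the
          real line; the factor 1 is the inner derivative.\<close>
        have "((\<lambda>w. mat_exp ((w - of_real t0) \<cdot>\<^sub>m A) $$ (i, j)) has_field_derivative
            (A * flow A t0 t) $$ (i, j) * 1) (at (of_real t))"
          by (rule DERIV_chain2[of "\<lambda>z. mat_exp (z \<cdot>\<^sub>m A) $$ (i, j)"])
            (use has_field_derivative_mat_exp(1)[OF A i j] in \<open>auto intro!: derivative_eq_intros\<close>)
        from has_vector_derivative_real_field[OF this] show ?thesis by simp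
      qed
      then have "((\<lambda>s. \<Sum>j<n. z $ j * flow A t0 s $$ (i, j)) has_vector_derivative
          (\<Sum>j<n. z $ j * (A * flow A t0 t) $$ (i, j))) (at t)"
        by (intro has_vector_derivative_sum has_vector_derivative_cmult) auto
      moreover have "A *\<^sub>v (flow A t0 t *\<^sub>v z) = (A * flow A t0 t) *\<^sub>v z"
        by (rule assoc_mult_mat_vec[OF A E z, symmetric])
      ultimately show "((\<lambda>s. (flow A t0 s *\<^sub>v z) $ i) has_vector_derivative
          (A *\<^sub>v (flow A t0 t *\<^sub>v z)) $ i) (at t)"
        unfolding index_mult_mat_vec_sum[OF E z i]
        by (simp only: index_mult_mat_vec_sum[OF mult_carrier_mat[OF A E] z i] mult.commute)
    qed
  qed
qed

text \<open>The function s -> exp((t0 - s)A) Y(s) is constant: its derivative is exp((t0 - s)A) Y' -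
  exp((t0 - s)A) A Y, which vanishes because Y' = A Y. Its value at s = t0 is Y(t0).\<close>

lemma reversed_flow_solution:
  assumes A: "A \<in> carrier_mat n n" and Y: "is_solution (1\<^sub>m n) A Y"
  shows "flow A t t0 *\<^sub>v Y t = Y t0"
proof (rule eq_vecI)
  note Yc = is_solution_carrier[OF Y one_carrier_mat]
  have E: "flow A t t0 \<in> carrier_mat n n" for t using A by (simp add: mat_exp_carrier)
  show "dim_vec (flow A t t0 *\<^sub>v Y t) = dim_vec (Y t0)" using Yc[of t0] E[of t] by auto
  fix i assume "i < dim_vec (Y t0)"
  then have i: "i < n" using Yc[of t0] by auto
  have "((\<lambda>s. (flow A s t0 *\<^sub>v Y s) $ i) has_vector_derivative 0) (at t)" for t
  proof -
    obtain D where D: "has_vec_deriv n Y D t" "1\<^sub>m n *\<^sub>v D = A *\<^sub>v Y t"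
      by (rule is_solutionE[OF Y one_carrier_mat])
    note Dc = has_vec_derivD[OF D(1)]
    have DA: "D = A *\<^sub>v Y t" using D(2) Dc(1) by simp
    have "((\<lambda>s. flow A s t0 $$ (i, j)) has_vector_derivative - (flow A t t0 * A) $$ (i, j)) (at t)"
      if j: "j < n" for j
    proof -
      have "((\<lambda>w. mat_exp ((of_real t0 - w) \<cdot>\<^sub>m A) $$ (i, j)) has_field_derivative
          (flow A t t0 * A) $$ (i, j) * (-1)) (at (of_real t))"
        by (rule DERIV_chain2[of "\<lambda>z. mat_exp (z \<cdot>\<^sub>m A) $$ (i, j)"])
          (use has_field_derivative_mat_exp(2)[OF A i j] in \<open>auto intro!: derivative_eq_intros\<close>)
      from has_vector_derivative_real_field[OF this] show ?thesis by simp
    qed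
    then have "((\<lambda>s. \<Sum>j<n. flow A s t0 $$ (i, j) * Y s $ j) has_vector_derivative
        (\<Sum>j<n. flow A t t0 $$ (i, j) * D $ j + - (flow A t t0 * A) $$ (i, j) * Y t $ j)) (at t)"
      by (intro has_vector_derivative_sum has_vector_derivative_mult Dc(2)) auto
    moreover have "(\<Sum>j<n. flow A t t0 $$ (i, j) * D $ j + - (flow A t t0 * A) $$ (i, j) * Y t $ j)
        = (flow A t t0 *\<^sub>v D) $ i - ((flow A t t0 * A) *\<^sub>v Y t) $ i"
      unfolding index_mult_mat_vec_sum[OF E Dc(1) i] index_mult_mat_vec_sum[OF mult_carrier_mat[OF E A] Yc i]
      by (simp add: sum_subtractf)
    moreover have "flow A t t0 *\<^sub>v D = (flow A t t0 * A) *\<^sub>v Y t"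
      unfolding DA by (rule assoc_mult_mat_vec[OF E A Yc, symmetric])
    ultimately show ?thesis unfolding index_mult_mat_vec_sum[OF E Yc i] by simp
  qed
  from constant_of_zero_vector_derivative[OF this, of t t0]
  have "(flow A t t0 *\<^sub>v Y t) $ i = (flow A t0 t0 *\<^sub>v Y t0) $ i" .
  also have "\<dots> = Y t0 $ i" using mat_exp_zero[OF A] Yc[of t0] by simp
  finally show "(flow A t t0 *\<^sub>v Y t) $ i = Y t0 $ i" .
qed

lemma flow_start:
  "A \<in> carrier_mat n n \<Longrightarrow> z \<in> carrier_vec n \<Longrightarrow> flow A t0 t0 *\<^sub>v z = z"
  using mat_exp_zero[of A n] by simp

lemma solution_eq_flow:
  assumes A: "A \<in> carrier_mat n n" and Y: "is_solution (1\<^sub>m n) A Y"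
  shows "Y t = flow A t0 t *\<^sub>v Y t0"
proof -
  have c: "Y t \<in> carrier_vec n" by (rule is_solution_carrier[OF Y one_carrier_mat])
  \<comment> \<open>The constancy is applied to the flow that starts at time t from Y(t), observed
    at time t0; this makes the two propagators inverse to each other.\<close>
  have "flow A t0 t *\<^sub>v (flow A t t0 *\<^sub>v Y t) = flow A t t *\<^sub>v Y t"
    by (rule reversed_flow_solution[OF A is_solution_flow[OF A c, of t]])
  also have "\<dots> = Y t" by (rule flow_start[OF A c])
  finally show ?thesis unfolding reversed_flow_solution[OF A Y] by (rule sym)
qed

section \<open>The Kronecker canonical form\<close>

text \<open>Everything after the block of the finite elementary divisors, so that the whole form is
  one \<open>dsum\<close> whose first part belongs to the first p columns of Q.\<close>

definition kronecker_tail_F :: "nat list \<Rightarrow> nat list \<Rightarrow> nat list \<Rightarrow> nat \<Rightarrow> nat \<Rightarrow> complex mat" where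
  "kronecker_tail_F qs es zs h g =
     dsum (jordan_matrix (map (\<lambda>n. (n, 0)) qs)) (dsum (diag_block_mat (map left_id_block es))
       (dsum (diag_block_mat (map (\<lambda>n. transpose_mat (left_id_block n)) zs)) (0\<^sub>m h g)))"

definition kronecker_tail_G :: "nat list \<Rightarrow> nat list \<Rightarrow> nat list \<Rightarrow> nat \<Rightarrow> nat \<Rightarrow> complex mat" where
  "kronecker_tail_G qs es zs h g =
     dsum (1\<^sub>m (sum_list qs)) (dsum (diag_block_mat (map right_id_block es))
       (dsum (diag_block_mat (map (\<lambda>n. transpose_mat (right_id_block n)) zs)) (0\<^sub>m h g)))"

lemma kronecker_eq_dsum:
  "kronecker_F jbs qs es zs h g = dsum (1\<^sub>m (sum_list (map fst jbs))) (kronecker_tail_F qs es zs h g)"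
  "kronecker_G jbs qs es zs h g = dsum (jordan_matrix jbs) (kronecker_tail_G qs es zs h g)"
  \<comment> \<open>The pattern \<open>_ # _\<close> for the rest of the list keeps the last block
    from being split once more into a sum with an empty matrix.\<close>
  unfolding kronecker_F_def kronecker_G_def kronecker_tail_F_def kronecker_tail_G_def
    diag_block_mat_Cons_dsum[of _ "_ # _"] diag_block_mat_singleton by (rule refl)+

lemma nilpotent_carrier:
  "jordan_matrix (map (\<lambda>n. (n, 0 :: complex)) qs) \<in> carrier_mat (sum_list qs) (sum_list qs)"
proof -
  have s: "sum_list (map fst (map (\<lambda>n. (n, 0::complex)) qs)) = sum_list qs" by (simp add: comp_def)
  show ?thesis using jordan_matrix_carrier[of "map (\<lambda>n. (n, 0::complex)) qs"] unfolding s .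
qed

lemma column_blocks_carrier:
  "diag_block_mat (map left_id_block es) \<in> carrier_mat (sum_list (map (\<lambda>n. n) es)) (sum_list (map (\<lambda>n. n + 1) es))"
  "diag_block_mat (map right_id_block es) \<in> carrier_mat (sum_list (map (\<lambda>n. n) es)) (sum_list (map (\<lambda>n. n + 1) es))"
  by (rule diag_block_mat_carrier_map, rule id_block_carrier)+

lemma row_blocks_carrier:
  "diag_block_mat (map (\<lambda>n. transpose_mat (left_id_block n)) zs)
    \<in> carrier_mat (sum_list (map (\<lambda>n. n + 1) zs)) (sum_list (map (\<lambda>n. n) zs))"
  "diag_block_mat (map (\<lambda>n. transpose_mat (right_id_block n)) zs)
    \<in> carrier_mat (sum_list (map (\<lambda>n. n + 1) zs)) (sum_list (map (\<lambda>n. n) zs))"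
  by (rule diag_block_mat_carrier_map, simp add: id_block_carrier[simplified])+

text \<open>Hides the explicit sizes; what matters later is that both matrices share them.\<close>

lemma kronecker_tail_carrier:
  obtains k l where "kronecker_tail_F qs es zs h g \<in> carrier_mat k l"
    "kronecker_tail_G qs es zs h g \<in> carrier_mat k l"
proof (rule that)
  show "kronecker_tail_F qs es zs h g \<in> carrier_mat
      (sum_list qs + (sum_list (map (\<lambda>n. n) es) + (sum_list (map (\<lambda>n. n + 1) zs) + h)))
      (sum_list qs + (sum_list (map (\<lambda>n. n + 1) es) + (sum_list (map (\<lambda>n. n) zs) + g)))"
    unfolding kronecker_tail_F_def
    by (intro dsum_carrier nilpotent_carrier column_blocks_carrier row_blocks_carrier zero_carrier_mat)
  show "kronecker_tail_G qs es zs h g \<in> carrier_mat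
      (sum_list qs + (sum_list (map (\<lambda>n. n) es) + (sum_list (map (\<lambda>n. n + 1) zs) + h)))
      (sum_list qs + (sum_list (map (\<lambda>n. n + 1) es) + (sum_list (map (\<lambda>n. n) zs) + g)))"
    unfolding kronecker_tail_G_def
    by (intro dsum_carrier one_carrier_mat column_blocks_carrier row_blocks_carrier zero_carrier_mat)
qed

lemma has_poly_null_kronecker:
  assumes "es \<noteq> [] \<or> g > 0"
  shows "has_poly_null (kronecker_F jbs qs es zs h g) (kronecker_G jbs qs es zs h g)"
proof -
  note row = row_blocks_carrier[of zs] and col = column_blocks_carrier[of es]
  note z = zero_carrier_mat[of h g, where 'a = complex]
  have rz: "g > 0 \<Longrightarrow> has_poly_null
      (dsum (diag_block_mat (map (\<lambda>n. transpose_mat (left_id_block n)) zs)) (0\<^sub>m h g))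
      (dsum (diag_block_mat (map (\<lambda>n. transpose_mat (right_id_block n)) zs)) (0\<^sub>m h g))"
    by (rule has_poly_null_dsum[OF row(1) z row(2) z]) (simp add: has_poly_null_zero_block)
  have "es \<noteq> [] \<Longrightarrow> has_poly_null (diag_block_mat (map left_id_block es)) (diag_block_mat (map right_id_block es))"
  proof (cases es)
    case (Cons e es')
    show ?thesis unfolding Cons list.map(2) diag_block_mat_Cons_dsum
      by (rule has_poly_null_dsum[OF id_block_carrier(1) column_blocks_carrier(1)
            id_block_carrier(2) column_blocks_carrier(2)])
        (simp add: has_poly_null_column_block)
  qed simp
  with assms rz have "has_poly_null (diag_block_mat (map left_id_block es)) (diag_block_mat (map right_id_block es)) \<or>
      has_poly_null (dsum (diag_block_mat (map (\<lambda>n. transpose_mat (left_id_block n)) zs)) (0\<^sub>m h g))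
        (dsum (diag_block_mat (map (\<lambda>n. transpose_mat (right_id_block n)) zs)) (0\<^sub>m h g))"
    by blast
  from has_poly_null_dsum[OF col(1) dsum_carrier[OF row(1) z] col(2) dsum_carrier[OF row(2) z] this]
  have "has_poly_null (kronecker_tail_F qs es zs h g) (kronecker_tail_G qs es zs h g)"
    unfolding kronecker_tail_F_def kronecker_tail_G_def
    by (intro has_poly_null_dsum[OF nilpotent_carrier dsum_carrier[OF col(1) dsum_carrier[OF row(1) z]]
          one_carrier_mat dsum_carrier[OF col(2) dsum_carrier[OF row(2) z]] disjI2])
  moreover obtain k l where "kronecker_tail_F qs es zs h g \<in> carrier_mat k l"
    "kronecker_tail_G qs es zs h g \<in> carrier_mat k l" by (rule kronecker_tail_carrier)
  ultimately show ?thesis unfolding kronecker_eq_dsum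
    using has_poly_null_dsum[OF one_carrier_mat _ jordan_matrix_carrier] by blast
qed

text \<open>With no column minimal indices, the empty list gives a 0 by 0 block and the zero block
  has no columns; both are rigid for want of unknowns, and the other two blocks by the derivative
  chain.\<close>

lemma rigid_kronecker_tail:
  "rigid (kronecker_tail_F qs [] zs h 0) (kronecker_tail_G qs [] zs h 0)"
proof -
  note row = row_blocks_carrier[of zs]
  note z = zero_carrier_mat[of h 0, where 'a = complex]
  note e = zero_carrier_mat[of 0 0, where 'a = complex]
  show ?thesis
    unfolding kronecker_tail_F_def kronecker_tail_G_def list.map(1) diag_block_mat.simps(1)
    by (rule rigid_dsum[OF nilpotent_carrier dsum_carrier[OF e dsum_carrier[OF row(1) z]]
          one_carrier_mat dsum_carrier[OF e dsum_carrier[OF row(2) z]] rigid_nilpotent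
          rigid_dsum[OF e dsum_carrier[OF row(1) z] e dsum_carrier[OF row(2) z] rigid_no_cols[OF e]
            rigid_dsum[OF row(1) z row(2) z rigid_row_blocks rigid_no_cols[OF z]]]])
qed

section \<open>The general solution and its uniqueness\<close>

text \<open>The sum decouples: the first part obeys Z' = J Z and is determined by its value z at
  \<open>t0\<close>, and the rigid part can only be zero.\<close>

lemma is_solution_dsum_rigid_iff:
  assumes J: "J \<in> carrier_mat p p" and A: "A \<in> carrier_mat k l" and B: "B \<in> carrier_mat k l"
    and rigid: "rigid A B"
  shows "is_solution (dsum (1\<^sub>m p) A) (dsum J B) Y \<longleftrightarrow>
    (\<exists>z \<in> carrier_vec p. Y = (\<lambda>t. (flow J t0 t *\<^sub>v z) @\<^sub>v 0\<^sub>v l))"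
proof
  assume Y: "is_solution (dsum (1\<^sub>m p) A) (dsum J B) Y"
  note sol = is_solution_dsum[OF one_carrier_mat A J B Y]
  have l: "dim_col A = l" using A by simp
  let ?z = "vec_first (Y t0) p"
  have "Y t = (flow J t0 t *\<^sub>v ?z) @\<^sub>v 0\<^sub>v l" for t
  proof -
    have "Y t = vec_first (Y t) p @\<^sub>v vec_last (Y t) l"
      using is_solution_carrier[OF Y dsum_carrier[OF one_carrier_mat A]] by simp
    then show ?thesis
      using solution_eq_flow[OF J sol(1), of t t0] rigid[unfolded rigid_def l, rule_format, OF sol(2), of t]
      by metis
  qed
  then show "\<exists>z \<in> carrier_vec p. Y = (\<lambda>t. (flow J t0 t *\<^sub>v z) @\<^sub>v 0\<^sub>v l)"
    by (intro bexI[of _ ?z] ext vec_first_carrier)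
next
  assume "\<exists>z \<in> carrier_vec p. Y = (\<lambda>t. (flow J t0 t *\<^sub>v z) @\<^sub>v 0\<^sub>v l)"
  then obtain z where z: "z \<in> carrier_vec p" and Y: "Y = (\<lambda>t. (flow J t0 t *\<^sub>v z) @\<^sub>v 0\<^sub>v l)" by blast
  show "is_solution (dsum (1\<^sub>m p) A) (dsum J B) Y"
    unfolding Y by (rule is_solution_dsumI[OF one_carrier_mat A J B is_solution_flow[OF J z] is_solution_zero[OF A B]])
qed

lemma first_cols_carrier: "A \<in> carrier_mat m n \<Longrightarrow> first_cols k A \<in> carrier_mat m k"
  by (auto simp: first_cols_def)

text \<open>The zeros suppress all columns of Q after the first p; this is how Q_p enters the
  solution formula.\<close>

lemma mult_append_zero_eq_first_cols:
  assumes Q: "Q \<in> carrier_mat n (p + l)" and x: "x \<in> carrier_vec p"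
  shows "Q *\<^sub>v (x @\<^sub>v 0\<^sub>v l) = first_cols p Q *\<^sub>v x"
proof (rule eq_vecI)
  note c = first_cols_carrier[OF Q, of p]
  show "dim_vec (Q *\<^sub>v (x @\<^sub>v 0\<^sub>v l)) = dim_vec (first_cols p Q *\<^sub>v x)" using Q c by simp
  fix i assume "i < dim_vec (first_cols p Q *\<^sub>v x)"
  then have i: "i < n" using c by simp
  have d: "dim_vec x = p" using x by simp
  have xz: "x @\<^sub>v 0\<^sub>v l \<in> carrier_vec (p + l)" using x by simp
  have "(Q *\<^sub>v (x @\<^sub>v 0\<^sub>v l)) $ i = (\<Sum>j<p + l. Q $$ (i, j) * (x @\<^sub>v 0\<^sub>v l) $ j)"
    by (rule index_mult_mat_vec_sum[OF Q xz i])
  also have "\<dots> = (\<Sum>j<p. Q $$ (i, j) * (x @\<^sub>v 0\<^sub>v l) $ j)"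
    by (rule sum.mono_neutral_right) (auto simp: d)
  also have "\<dots> = (\<Sum>j<p. first_cols p Q $$ (i, j) * x $ j)"
    by (rule sum.cong) (use Q i d in \<open>auto simp: first_cols_def\<close>)
  also have "\<dots> = (first_cols p Q *\<^sub>v x) $ i"
    by (rule index_mult_mat_vec_sum[OF c x i, symmetric])
  finally show "(Q *\<^sub>v (x @\<^sub>v 0\<^sub>v l)) $ i = (first_cols p Q *\<^sub>v x) $ i" .
qed

lemma mem_colspan_iff:
  assumes A: "A \<in> carrier_mat n k" and y: "y \<in> carrier_vec n"
  shows "y \<in> colspan A \<longleftrightarrow> (\<exists>x \<in> carrier_vec k. y = A *\<^sub>v x)"
proof -
  have d: "dim_row A = n" "dim_col A = k" using A by auto
  show ?thesis unfolding colspan_def d vec_space.col_space_eq[OF A] using y by auto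
qed

lemma invertible_mat_inverse:
  assumes A: "A \<in> carrier_mat n n" and "invertible_mat A"
  obtains B where "B \<in> carrier_mat n n" "A * B = 1\<^sub>m n" "B * A = 1\<^sub>m n"
proof -
  obtain B where B: "A * B = 1\<^sub>m (dim_row A)" "B * A = 1\<^sub>m (dim_row B)"
    using assms(2) by (auto simp: invertible_mat_def inverts_mat_def)
  have "dim_col B = n" using arg_cong[OF B(1), of dim_col] A by simp
  moreover have r: "dim_row B = n" using arg_cong[OF B(2), of dim_col] A by simp
  ultimately have "B \<in> carrier_mat n n" by (intro carrier_matI)
  moreover have "dim_row A = n" using A by simp
  ultimately show ?thesis using that B unfolding r by metis
qed

text \<open>By linearity all Y + c Y with complex c are solutions, and a nonzero component of Y at t
  tells them apart.\<close>

lemma infinite_solutions: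
  assumes A: "A \<in> carrier_mat m n" and B: "B \<in> carrier_mat m n"
    and Y: "is_solution A B Y" and ne: "Y t \<noteq> 0\<^sub>v n"
  shows "infinite {Y. is_solution A B Y}"
proof -
  note Yc = is_solution_carrier[OF Y A]
  have d: "dim_vec (Y t) = n" using Yc[of t] by simp
  obtain i where i: "i < n" "Y t $ i \<noteq> 0"
  proof (rule ccontr)
    assume "\<not> thesis"
    then have "Y t $ i = 0" if "i < n" for i using that \<open>\<And>i. i < n \<Longrightarrow> Y t $ i \<noteq> 0 \<Longrightarrow> thesis\<close> by blast
    then have "Y t = 0\<^sub>v n" using d by (intro eq_vecI) simp_all
    with ne show False by contradiction
  qed
  let ?f = "\<lambda>c t. Y t + c \<cdot>\<^sub>v Y t"
  have "inj ?f"
  proof (rule injI)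
    fix b c assume "?f b = ?f c"
    then have "?f b t $ i = ?f c t $ i" by metis
    then show "b = c" using i d by simp
  qed
  then have "infinite (range ?f)" by (simp add: finite_image_iff infinite_UNIV_char_0)
  moreover have "range ?f \<subseteq> {Y. is_solution A B Y}"
    using is_solution_add_smult[OF A B Y Y] by auto
  ultimately show ?thesis using finite_subset by blast
qed

text \<open>Adding a nonzero solution that vanishes at \<open>t0\<close> to a given one keeps the
  initial value. If no solution has this initial value, existence already fails.\<close>

lemma not_unique_of_poly_null:
  assumes A: "A \<in> carrier_mat m n" and B: "B \<in> carrier_mat m n" and null: "has_poly_null A B"
  shows "\<not> (\<exists>!Y. is_solution A B Y \<and> Y t0 = Y0)"
proof
  assume ex1: "\<exists>!Y. is_solution A B Y \<and> Y t0 = Y0"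
  then obtain Y where Y: "is_solution A B Y" "Y t0 = Y0" by blast
  obtain W t where W: "is_solution A B W" "W t0 = 0\<^sub>v n" "W t \<noteq> 0\<^sub>v n"
    using nonzero_solution_of_poly_null[OF A B null, of t0] by blast
  note Yc = is_solution_carrier[OF Y(1) A] and Wc = is_solution_carrier[OF W(1) A]
  have "Y t0 + 1 \<cdot>\<^sub>v W t0 = Y0" unfolding W(2) smult_zero_vec_ring Y(2)[symmetric]
    using Yc[of t0] by simp
  then have eq: "(\<lambda>t. Y t + 1 \<cdot>\<^sub>v W t) = Y"
    using ex1 Y is_solution_add_smult[OF A B Y(1) W(1), of 1] by blast
  have "W t = 0\<^sub>v n"
  proof (rule eq_vecI)
    fix i assume "i < dim_vec (0\<^sub>v n :: complex vec)"
    then have i: "i < n" by simp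
    have "(Y t + 1 \<cdot>\<^sub>v W t) $ i = Y t $ i" using fun_cong[OF eq, of t] by simp
    then show "W t $ i = 0\<^sub>v n $ i" using i Yc[of t] Wc[of t] by simp
  qed (use Wc[of t] in simp)
  with W(3) show False by contradiction
qed

text \<open>The last conjunct concerns the system without initial condition. It leaves out the case
  without column minimal indices and with p = 0: there the zero function is the only solution, also
  when a nonzero initial value admits none.\<close>

theorem theorem3p1:
  fixes F G P Q Jp Qp :: "complex mat" and M N p h g :: nat
    and jbs :: "(nat \<times> complex) list" and qs es zs :: "nat list" and t0 :: real
  assumes "F \<in> carrier_mat M N" and "G \<in> carrier_mat M N"
    and "singular_pencil F G"
    and "Y0 \<in> carrier_vec N"
    and "P \<in> carrier_mat M M" and "invertible_mat P"
    and "Q \<in> carrier_mat N N" and "invertible_mat Q"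
    and "kronecker_data jbs qs es zs"
    and "P * F * Q = kronecker_F jbs qs es zs h g"
    and "P * G * Q = kronecker_G jbs qs es zs h g"
    and "p = sum_list (map fst jbs)"
    and "Jp = jordan_matrix jbs"
    and "Qp = first_cols p Q"
  shows "((\<exists>!Y. is_solution F G Y \<and> Y t0 = Y0) \<longleftrightarrow>
            dim_right_null F G = 0 \<and> Y0 \<in> colspan Qp)
    \<and> (dim_right_null F G = 0 \<and> Y0 \<in> colspan Qp \<longrightarrow>
            (\<exists>!Z. Z \<in> carrier_vec p \<and> Y0 = Qp *\<^sub>v Z) \<and>
            (\<forall>Z. Z \<in> carrier_vec p \<and> Y0 = Qp *\<^sub>v Z \<longrightarrow>
               (\<forall>Y. is_solution F G Y \<and> Y t0 = Y0 \<longleftrightarrow>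
                  Y = (\<lambda>t. Qp *\<^sub>v (mat_exp (complex_of_real (t - t0) \<cdot>\<^sub>m Jp) *\<^sub>v Z)))))
    \<and> (\<not> (dim_right_null F G = 0 \<and> Y0 \<in> colspan Qp)
         \<and> \<not> (dim_right_null F G = 0 \<and> p = 0) \<longrightarrow>
            infinite {Y. is_solution F G Y})"
proof -
  note F = assms(1) and G = assms(2) and Y0 = assms(4) and P = assms(5) and Q = assms(7)
  note KF = assms(10) and KG = assms(11) and p = assms(12) and Jp = assms(13) and Qp = assms(14)
  obtain P' where P': "P' \<in> carrier_mat M M" "P * P' = 1\<^sub>m M" "P' * P = 1\<^sub>m M"
    using invertible_mat_inverse[OF P assms(6)] .
  obtain Q' where Q': "Q' \<in> carrier_mat N N" "Q * Q' = 1\<^sub>m N" "Q' * Q = 1\<^sub>m N"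
    using invertible_mat_inverse[OF Q assms(8)] .
  show ?thesis
  proof (cases "has_poly_null F G")
    case True
    have "infinite {Y. is_solution F G Y}"
      using nonzero_solution_of_poly_null[OF F G True] infinite_solutions[OF F G] by blast
    then show ?thesis
      using not_unique_of_poly_null[OF F G True] True dim_right_null_eq_0_iff[OF F G] by blast
  next
    case False
    then have d: "dim_right_null F G = 0" using dim_right_null_eq_0_iff[OF F G] by blast
    \<comment> \<open>A column block or zero column in the Kronecker form would give a null vector
      there, and the equivalence would carry it back to F and G.\<close>
    have "es = [] \<and> g = 0"
    proof (rule ccontr)
      assume "\<not> ?thesis"
      then have "has_poly_null (P * F * Q) (P * G * Q)"
        unfolding KF KG by (intro has_poly_null_kronecker) auto
      with False show False
        using has_poly_null_transform[OF F G P P'(1,3) Q Q'(1,3)] by blast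
    qed
    then have es: "es = []" and g: "g = 0" by blast+
    obtain k l where T: "kronecker_tail_F qs [] zs h 0 \<in> carrier_mat k l"
      "kronecker_tail_G qs [] zs h 0 \<in> carrier_mat k l" by (rule kronecker_tail_carrier)
    have J: "Jp \<in> carrier_mat p p" unfolding p Jp by (rule jordan_matrix_carrier)
    note K = KF[unfolded kronecker_eq_dsum es g, folded p] KG[unfolded kronecker_eq_dsum es g, folded Jp]
    have N: "N = p + l"
      using arg_cong[OF K(1), of dim_col] dsum_carrier[OF one_carrier_mat[of p] T(1)] Q by simp
    have Qpc: "Qp \<in> carrier_mat N p" unfolding Qp by (rule first_cols_carrier[OF Q])
    have QQp: "Q *\<^sub>v (x @\<^sub>v 0\<^sub>v l) = Qp *\<^sub>v x" if "x \<in> carrier_vec p" for x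
      unfolding Qp by (rule mult_append_zero_eq_first_cols) (use Q N that in auto)
    \<comment> \<open>The first p columns of the invertible Q are linearly independent: after
      padding with zeros, Q^-1 recovers the vector.\<close>
    have inj: "x = y" if xy: "x \<in> carrier_vec p" "y \<in> carrier_vec p" and eq: "Qp *\<^sub>v x = Qp *\<^sub>v y" for x y
    proof -
      have c: "v @\<^sub>v 0\<^sub>v l \<in> carrier_vec N" if "v \<in> carrier_vec p" for v using that N by simp
      have "Q' *\<^sub>v (Q *\<^sub>v (v @\<^sub>v 0\<^sub>v l)) = v @\<^sub>v 0\<^sub>v l" if "v \<in> carrier_vec p" for v
        using assoc_mult_mat_vec[OF Q'(1) Q c[OF that]] Q'(3) one_mult_mat_vec[OF c[OF that]] by simp
      then have "x @\<^sub>v 0\<^sub>v l = y @\<^sub>v 0\<^sub>v l" using QQp xy eq by metis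
      then show ?thesis using append_vec_eq[OF xy] by blast
    qed
    have flow_c: "flow Jp t0 t *\<^sub>v z \<in> carrier_vec p" if "z \<in> carrier_vec p" for t z
      using is_solution_carrier[OF is_solution_flow[OF J that] one_carrier_mat] .
    have QQ'v: "Q *\<^sub>v (Q' *\<^sub>v v) = v" if "v \<in> carrier_vec N" for v
      using assoc_mult_mat_vec[OF Q Q'(1) that] Q'(2) that by simp
    note block_sol = is_solution_dsum_rigid_iff[OF J T rigid_kronecker_tail, of _ t0]
    have sol: "is_solution F G Y \<longleftrightarrow> (\<exists>z \<in> carrier_vec p. Y = (\<lambda>t. Qp *\<^sub>v (flow Jp t0 t *\<^sub>v z)))" for Y
    proof
      assume Y: "is_solution F G Y"
      obtain z where z: "z \<in> carrier_vec p"
        and eq: "(\<lambda>t. Q' *\<^sub>v Y t) = (\<lambda>t. (flow Jp t0 t *\<^sub>v z) @\<^sub>v 0\<^sub>v l)"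
        using is_solution_transform[OF F G P Q Q'(1,2) Y] unfolding K block_sol by blast
      have "Y t = Qp *\<^sub>v (flow Jp t0 t *\<^sub>v z)" for t
      proof -
        have "Y t = Q *\<^sub>v (Q' *\<^sub>v Y t)" using QQ'v[OF is_solution_carrier[OF Y F]] by simp
        also have "\<dots> = Q *\<^sub>v ((flow Jp t0 t *\<^sub>v z) @\<^sub>v 0\<^sub>v l)" using fun_cong[OF eq, of t] by simp
        also have "\<dots> = Qp *\<^sub>v (flow Jp t0 t *\<^sub>v z)" by (rule QQp[OF flow_c[OF z]])
        finally show ?thesis .
      qed
      then show "\<exists>z \<in> carrier_vec p. Y = (\<lambda>t. Qp *\<^sub>v (flow Jp t0 t *\<^sub>v z))" using z by blast
    next
      assume "\<exists>z \<in> carrier_vec p. Y = (\<lambda>t. Qp *\<^sub>v (flow Jp t0 t *\<^sub>v z))"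
      then obtain z where z: "z \<in> carrier_vec p" and Y: "Y = (\<lambda>t. Qp *\<^sub>v (flow Jp t0 t *\<^sub>v z))" by blast
      have Z: "is_solution (P * F * Q) (P * G * Q) (\<lambda>t. (flow Jp t0 t *\<^sub>v z) @\<^sub>v 0\<^sub>v l)"
        unfolding K block_sol using z by blast
      have PFQ: "P * X * Q \<in> carrier_mat M N" if "X \<in> carrier_mat M N" for X using P Q that by simp
      \<comment> \<open>Transforming the Kronecker form by the inverses must be recognised as the
        original pair before solutions can be carried back.\<close>
      have cancel: "P' * (P * X * Q) * Q' = X" if X: "X \<in> carrier_mat M N" for X
      proof -
        have "P' * (P * X * Q) = P' * (P * (X * Q))" by (simp only: assoc_mult_mat[OF P X Q])
        also have "\<dots> = (P' * P) * (X * Q)"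
          by (rule assoc_mult_mat[OF P'(1) P mult_carrier_mat[OF X Q], symmetric])
        also have "\<dots> = X * Q" unfolding P'(3) by (rule left_mult_one_mat[OF mult_carrier_mat[OF X Q]])
        finally have "P' * (P * X * Q) * Q' = X * (Q * Q')"
          by (simp only: assoc_mult_mat[OF X Q Q'(1)])
        then show ?thesis unfolding Q'(2) right_mult_one_mat[OF X] .
      qed
      have "is_solution F G (\<lambda>t. Q *\<^sub>v ((flow Jp t0 t *\<^sub>v z) @\<^sub>v 0\<^sub>v l))"
        using is_solution_transform[OF PFQ[OF F] PFQ[OF G] P'(1) Q'(1) Q Q'(3) Z]
        unfolding cancel[OF F] cancel[OF G] .
      then show "is_solution F G Y" unfolding Y QQp[OF flow_c[OF z]] .
    qed
    have span: "Y0 \<in> colspan Qp \<longleftrightarrow> (\<exists>z \<in> carrier_vec p. Y0 = Qp *\<^sub>v z)"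
      by (rule mem_colspan_iff[OF Qpc Y0])
    note start = flow_start[OF J, of _ t0]
    \<comment> \<open>At \<open>t0\<close> the general solution takes the value Q_p w, so the
      initial condition fixes w by injectivity of Q_p.\<close>
    have unique: "is_solution F G Y \<and> Y t0 = Y0 \<longleftrightarrow> Y = (\<lambda>t. Qp *\<^sub>v (flow Jp t0 t *\<^sub>v z))"
      if z: "z \<in> carrier_vec p" "Y0 = Qp *\<^sub>v z" for z Y
    proof
      assume Y: "is_solution F G Y \<and> Y t0 = Y0"
      then obtain w where w: "w \<in> carrier_vec p" "Y = (\<lambda>t. Qp *\<^sub>v (flow Jp t0 t *\<^sub>v w))"
        using sol by blast
      have "Qp *\<^sub>v w = Qp *\<^sub>v z" using Y z(2) w(2) start[OF w(1)] by simp
      then show "Y = (\<lambda>t. Qp *\<^sub>v (flow Jp t0 t *\<^sub>v z))" using inj w z(1) by metis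
    next
      assume "Y = (\<lambda>t. Qp *\<^sub>v (flow Jp t0 t *\<^sub>v z))"
      then show "is_solution F G Y \<and> Y t0 = Y0" using sol z start[OF z(1)] by auto
    qed
    have ex1: "(\<exists>!Y. is_solution F G Y \<and> Y t0 = Y0) \<longleftrightarrow> Y0 \<in> colspan Qp"
    proof
      assume "\<exists>!Y. is_solution F G Y \<and> Y t0 = Y0"
      then obtain Y where Y: "is_solution F G Y" "Y t0 = Y0" by blast
      then obtain z where z: "z \<in> carrier_vec p" "Y = (\<lambda>t. Qp *\<^sub>v (flow Jp t0 t *\<^sub>v z))"
        using sol by blast
      then have "Y0 = Qp *\<^sub>v z" using Y(2) start[OF z(1)] by simp
      then show "Y0 \<in> colspan Qp" using span z(1) by blast
    next
      assume "Y0 \<in> colspan Qp"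
      then obtain z where z: "z \<in> carrier_vec p" "Y0 = Qp *\<^sub>v z" using span by blast
      show "\<exists>!Y. is_solution F G Y \<and> Y t0 = Y0" unfolding unique[OF z] by (rule ex1_eq(1))
    qed
    \<comment> \<open>A nonzero starting vector exists because p is positive; injectivity of Q_p
      keeps its solution nonzero at \<open>t0\<close>, and scaling does the rest.\<close>
    have inf: "infinite {Y. is_solution F G Y}" if p0: "p \<noteq> 0"
    proof -
      let ?u = "unit_vec p 0 :: complex vec"
      let ?Y = "\<lambda>t. Qp *\<^sub>v (flow Jp t0 t *\<^sub>v ?u)"
      have u: "?u \<in> carrier_vec p" by simp
      have Y: "is_solution F G ?Y" unfolding sol using u by blast
      have "?Y t0 \<noteq> 0\<^sub>v N"
      proof
        assume "?Y t0 = 0\<^sub>v N"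
        then have "Qp *\<^sub>v ?u = Qp *\<^sub>v 0\<^sub>v p" using start[OF u] mult_mat_vec_zero[OF Qpc] by simp
        from inj[OF u zero_carrier_vec this] have "?u $ 0 = 0\<^sub>v p $ 0" by (rule arg_cong)
        then show False using p0 by simp
      qed
      from infinite_solutions[OF F G Y this] show ?thesis .
    qed
    show ?thesis
    proof (intro conjI impI)
      show "(\<exists>!Y. is_solution F G Y \<and> Y t0 = Y0) \<longleftrightarrow> dim_right_null F G = 0 \<and> Y0 \<in> colspan Qp"
        unfolding ex1 using d by blast
    next
      assume "dim_right_null F G = 0 \<and> Y0 \<in> colspan Qp"
      then obtain z where z: "z \<in> carrier_vec p" "Y0 = Qp *\<^sub>v z" using span by blast
      show "\<exists>!Z. Z \<in> carrier_vec p \<and> Y0 = Qp *\<^sub>v Z"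
      proof (rule ex1I[of _ z])
        fix Z assume Z: "Z \<in> carrier_vec p \<and> Y0 = Qp *\<^sub>v Z"
        show "Z = z" by (rule inj) (use Z z in simp_all)
      qed (use z in blast)
    next
      show "\<forall>Z. Z \<in> carrier_vec p \<and> Y0 = Qp *\<^sub>v Z \<longrightarrow>
          (\<forall>Y. is_solution F G Y \<and> Y t0 = Y0 \<longleftrightarrow> Y = (\<lambda>t. Qp *\<^sub>v (flow Jp t0 t *\<^sub>v Z)))"
      proof (rule allI, rule impI, rule allI)
        fix Z Y assume Z: "Z \<in> carrier_vec p \<and> Y0 = Qp *\<^sub>v Z"
        show "is_solution F G Y \<and> Y t0 = Y0 \<longleftrightarrow> Y = (\<lambda>t. Qp *\<^sub>v (flow Jp t0 t *\<^sub>v Z))"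
          by (rule unique[OF conjunct1[OF Z] conjunct2[OF Z]])
      qed
    next
      assume "\<not> (dim_right_null F G = 0 \<and> Y0 \<in> colspan Qp) \<and> \<not> (dim_right_null F G = 0 \<and> p = 0)"
      then show "infinite {Y. is_solution F G Y}" using d inf by blast
    qed
  qed
qed

end
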